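(* For any bounded open set $\mathcal{O}\subset\mathbb{R}^d$, there exists $\delta>0$ such that for $m_X$-almost any lattice $x\in X$, $$\dim_H F_{S^+(\mathcal{O})}(x)\le d-\delta.$$
   Context: Fix $d\ge 2$ and $a_t=\mathrm{diag}(e^{c_1t},\dots,e^{c_dt})$, where $c_1,\dots,c_d$ are fixed non-zero real numbers with $\sum_j c_j=0$. For a bounded open set $\mathcal{O}\subset\mathbb{R}^d$, its positive spike with respect to $a_t$ is $S^+(\mathcal{O})=\bigcup_{t>0}a_t^{-1}\mathcal{O}$. $X\simeq \mathrm{SL}_d(\mathbb{R})/\mathrm{SL}_d(\mathbb{Z})$ is the space of unimodular (covolume 1) lattices in $\mathbb{R}^d$, and $m_X$ is its unique $\mathrm{SL}_d(\mathbb{R})$-invariant Borel probability measure. A unimodular grid is a coset $x+w$ with $x\in X$, $w\in\mathbb{R}^d$; $Y$ is the space of unimodular grids in $\mathbb{R}^d$ and $\pi:Y\to X$, $x+w\mapsto x$, is the natural projection, so $\pi^{-1}(x)$ is the torus $\mathbb{R}^d/x$. Set $F_{S^+(\mathcal{O})}(x)=\{y\in\pi^{-1}(x): y\cap S^+(\mathcal{O})\text{ is finite}\}$. $\dim_H$ denotes Hausdorff dimension with respect to the Euclidean metric on $\pi^{-1}(x)\simeq\mathbb{R}^d/x$.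
   Formalization: The bounded open set O is assumed nonempty: for the empty set the spike is empty, every grid meets it in a finite set, and F is the whole d-dimensional torus, so the claim fails. *)

theory Defs
  imports "HOL-Probability.Probability"
begin

section \<open>Hausdorff dimension in a metric space\<close>

definition mdiam :: "'a metric \<Rightarrow> 'a set \<Rightarrow> ennreal" where
  "mdiam M U = (SUP x\<in>U. SUP y\<in>U. ennreal (mdist M x y))"

text \<open>The contribution $\mathrm{diam}(U)^s$ of a covering set of finite diameter. Since
  \<^term>\<open>0 powr 0 = (0::real)\<close> in HOL, the case \<open>s = 0\<close> is separate, so that the 0-dimensional
  measure is counting measure.\<close>

definition hausdorff_gauge :: "'a metric \<Rightarrow> real \<Rightarrow> 'a set \<Rightarrow> ennreal" where
  "hausdorff_gauge M s U =
     (if U = {} then 0 else if s = 0 then 1 else ennreal (enn2real (mdiam M U) powr s))"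

definition hausdorff_content :: "'a metric \<Rightarrow> real \<Rightarrow> real \<Rightarrow> 'a set \<Rightarrow> ennreal" where
  "hausdorff_content M s e A =
     Inf {(\<Sum>i. hausdorff_gauge M s (U i)) | U :: nat \<Rightarrow> 'a set.
            (\<forall>i. U i \<subseteq> mspace M \<and> mdiam M (U i) \<le> ennreal e) \<and> A \<subseteq> (\<Union>i. U i)}"

definition hausdorff_measure :: "'a metric \<Rightarrow> real \<Rightarrow> 'a set \<Rightarrow> ennreal" where
  "hausdorff_measure M s A = (SUP e\<in>{0<..}. hausdorff_content M s e A)"

definition hausdorff_dim :: "'a metric \<Rightarrow> 'a set \<Rightarrow> ereal" where
  "hausdorff_dim M A = Inf {ereal s | s. 0 \<le> s \<and> hausdorff_measure M s A = 0}"


section \<open>The space of unimodular lattices\<close>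

definition SL :: "(real^'n^'n) set" where
  "SL = {g. det g = 1}"

definition int_lattice :: "(real^'n) set" where
  "int_lattice = {v. \<forall>i. v $ i \<in> \<int>}"

text \<open>The orbit map $g \mapsto g\mathbb{Z}^d$ identifies $\mathrm{SL}_d(\mathbb{R})/
  \mathrm{SL}_d(\mathbb{Z})$ with the set of lattices of covolume 1, and the topology is
  the quotient topology.\<close>

definition lattice_of :: "real^'n^'n \<Rightarrow> (real^'n) set" where
  "lattice_of g = (*v) g ` int_lattice"

definition unimodular_lattices :: "(real^'n) set set" where
  "unimodular_lattices = lattice_of ` SL"

definition lattice_topology :: "(real^'n) set topology" where
  "lattice_topology = topology (\<lambda>U. U \<subseteq> unimodular_lattices \<and>
     openin (top_of_set SL) {g \<in> SL. lattice_of g \<in> U})"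

lemma openin_lattice_topology:
  fixes U :: "(real^'n) set set"
  shows "openin lattice_topology U \<longleftrightarrow>
     U \<subseteq> unimodular_lattices \<and> openin (top_of_set SL) {g \<in> SL. lattice_of g \<in> U}"
proof -
  have inter: "{g \<in> SL. lattice_of g \<in> S \<inter> T} =
      {g \<in> SL. lattice_of g \<in> S} \<inter> {g \<in> SL. lattice_of g \<in> T}" for S T :: "(real^'n) set set"
    by auto
  have union: "{g \<in> SL. lattice_of g \<in> \<Union>K} = (\<Union>S\<in>K. {g \<in> SL. lattice_of g \<in> S})"
    for K :: "(real^'n) set set set"
    by auto
  have "istopology (\<lambda>U :: (real^'n) set set. U \<subseteq> unimodular_lattices \<and>
     openin (top_of_set SL) {g \<in> SL. lattice_of g \<in> U})"
    unfolding istopology_def inter union by (auto intro!: openin_Int openin_Union)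
  then show ?thesis
    by (simp add: lattice_topology_def topology_inverse')
qed

lemma topspace_lattice_topology: "topspace lattice_topology = (unimodular_lattices :: (real^'n) set set)"
proof
  show "topspace lattice_topology \<subseteq> (unimodular_lattices :: (real^'n) set set)"
    by (auto simp: topspace_def openin_lattice_topology)
  have "{g \<in> SL. lattice_of g \<in> unimodular_lattices} = (SL :: (real^'n^'n) set)"
    by (auto simp: unimodular_lattices_def)
  then have "openin lattice_topology (unimodular_lattices :: (real^'n) set set)"
    by (simp add: openin_lattice_topology)
  then show "(unimodular_lattices :: (real^'n) set set) \<subseteq> topspace lattice_topology"
    by (rule openin_subset)
qed

text \<open>This characterises the measure $m_X$, which exists and is unique.\<close>

definition invariant_lattice_measure :: "(real^'n) set measure \<Rightarrow> bool" where
  "invariant_lattice_measure m \<longleftrightarrow>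
     prob_space m \<and>
     space m = unimodular_lattices \<and>
     sets m = sigma_sets unimodular_lattices {U. openin lattice_topology U} \<and>
     (\<forall>g\<in>SL. \<forall>A\<in>sets m. emeasure m ((\<lambda>x. (*v) g ` x) ` A) = emeasure m A)"


section \<open>Grids\<close>

definition unimodular_grids :: "(real^'n) set set" where
  "unimodular_grids = {(+) w ` x | w x. x \<in> unimodular_lattices}"

text \<open>The projection $\pi(x + w) = x$, with $x$ recovered as the set of differences of points of
  the grid.\<close>

definition grid_proj :: "(real^'n) set \<Rightarrow> (real^'n) set" where
  "grid_proj y = {u - v | u v. u \<in> y \<and> v \<in> y}"

definition grid_fibre :: "(real^'n) set \<Rightarrow> (real^'n) set set" where
  "grid_fibre x = {y \<in> unimodular_grids. grid_proj y = x}"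

text \<open>The Euclidean metric on $\pi^{-1}(x) \simeq \mathbb{R}^d/x$: the quotient distance
  $\inf_{u \in x} \|v - w + u\|$ of the cosets of $v$ and $w$ is the distance between the two
  cosets as subsets of $\mathbb{R}^d$.\<close>

definition torus_metric :: "(real^'n) set \<Rightarrow> (real^'n) set metric" where
  "torus_metric x = metric (grid_fibre x, setdist)"

lemma unimodular_lattice_props:
  fixes x :: "(real^'n) set"
  assumes "x \<in> unimodular_lattices"
  shows "0 \<in> x" "closed x" "u \<in> x \<Longrightarrow> v \<in> x \<Longrightarrow> u + v \<in> x" "u \<in> x \<Longrightarrow> - u \<in> x"
proof -
  obtain g :: "real^'n^'n" where g: "det g = 1" "x = (*v) g ` int_lattice"
    using assms by (auto simp: unimodular_lattices_def SL_def lattice_of_def)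
  show "0 \<in> x"
    unfolding g by (rule image_eqI[of _ _ 0]) (auto simp: int_lattice_def)
  have "closed ((\<lambda>v :: real^'n. v $ i) -` \<int>)" for i
    by (intro closed_vimage continuous_intros closed_Ints)
  then have "closed (\<Inter>i. (\<lambda>v :: real^'n. v $ i) -` \<int>)"
    by blast
  moreover have "(\<Inter>i. (\<lambda>v :: real^'n. v $ i) -` \<int>) = int_lattice"
    by (auto simp: int_lattice_def)
  ultimately have "closed (int_lattice :: (real^'n) set)"
    by simp
  moreover have "inj ((*v) g)"
    using g(1) by (intro inj_matrix_vector_mult) (simp add: invertible_det_nz)
  ultimately show "closed x"
    unfolding g by (intro closed_injective_linear_image) auto
  show "u + v \<in> x" if uv: "u \<in> x" "v \<in> x"
  proof -
    obtain a b where "a \<in> int_lattice" "b \<in> int_lattice" "u = g *v a" "v = g *v b"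
      using uv unfolding g by auto
    then show ?thesis
      unfolding g by (intro image_eqI[of _ _ "a + b"])
        (auto simp: int_lattice_def matrix_vector_right_distrib)
  qed
  show "- u \<in> x" if u: "u \<in> x"
  proof -
    obtain a where "a \<in> int_lattice" "u = g *v a"
      using u unfolding g by auto
    then show ?thesis
      unfolding g by (intro image_eqI[of _ _ "- a"])
        (auto simp: int_lattice_def linear_neg[OF matrix_vector_mul_linear])
  qed
qed

lemma grid_proj_translate:
  assumes "x \<in> unimodular_lattices"
  shows "grid_proj ((+) w ` x) = x"
proof
  show "grid_proj ((+) w ` x) \<subseteq> x"
  proof
    fix z assume "z \<in> grid_proj ((+) w ` x)"
    then obtain u v where "u \<in> x" "v \<in> x" "z = u + - v"
      by (auto simp: grid_proj_def)
    then show "z \<in> x" using unimodular_lattice_props[OF assms] by blast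
  qed
  show "x \<subseteq> grid_proj ((+) w ` x)"
  proof
    fix z assume "z \<in> x"
    moreover have "z = (w + z) - (w + 0)" by simp
    ultimately show "z \<in> grid_proj ((+) w ` x)"
      unfolding grid_proj_def using unimodular_lattice_props(1)[OF assms] by blast
  qed
qed

lemma grid_fibre_eq:
  assumes "x \<in> unimodular_lattices"
  shows "grid_fibre x = range (\<lambda>w. (+) w ` x)"
  using assms grid_proj_translate unfolding grid_fibre_def unimodular_grids_def by blast

lemma setdist_translates:
  fixes x :: "(real^'n) set"
  assumes x: "x \<in> unimodular_lattices" and u: "u \<in> (+) v ` x"
  shows "setdist ((+) v ` x) ((+) w ` x) = setdist {u} ((+) w ` x)"
proof (rule antisym)
  note p = unimodular_lattice_props[OF x]
  show "setdist ((+) v ` x) ((+) w ` x) \<le> setdist {u} ((+) w ` x)"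
    using u by (intro setdist_subset_left) auto
  show "setdist {u} ((+) w ` x) \<le> setdist ((+) v ` x) ((+) w ` x)"
  proof (rule le_setdistI)
    show "(+) v ` x \<noteq> {}" "(+) w ` x \<noteq> {}" using p(1) by auto
    fix a b assume "a \<in> (+) v ` x" "b \<in> (+) w ` x"
    then obtain a' b' u' where ab: "a' \<in> x" "b' \<in> x" "u' \<in> x" "a = v + a'" "b = w + b'" "u = v + u'"
      using u by auto
    have "b' + (u' + - a') \<in> x" using ab p by blast
    then have "b + (u' + - a') \<in> (+) w ` x"
      unfolding ab by (intro image_eqI[of _ _ "b' + (u' + - a')"]) (auto simp: add.assoc)
    then have "setdist {u} ((+) w ` x) \<le> dist u (b + (u' + - a'))"
      by (intro setdist_le_dist) auto
    also have "\<dots> = dist a b"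
      unfolding ab dist_norm by (simp add: algebra_simps)
    finally show "setdist {u} ((+) w ` x) \<le> dist a b" .
  qed
qed

lemma Metric_space_grid_fibre:
  fixes x :: "(real^'n) set"
  assumes x: "x \<in> unimodular_lattices"
  shows "Metric_space (grid_fibre x) setdist"
proof
  note p = unimodular_lattice_props[OF x]
  show "0 \<le> setdist y z" for y z :: "(real^'n) set" by simp
  show "setdist y z = setdist z y" for y z :: "(real^'n) set" by (rule setdist_sym)
  fix y z assume "y \<in> grid_fibre x" "z \<in> grid_fibre x"
  then obtain v w where yz: "y = (+) v ` x" "z = (+) w ` x"
    by (auto simp: grid_fibre_eq[OF x])
  have v: "v \<in> y" unfolding yz using p(1) by (intro image_eqI[of _ _ 0]) auto
  have eq: "setdist y z = setdist {v} z"
    using setdist_translates[OF x] v unfolding yz by blast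
  show "setdist y z = 0 \<longleftrightarrow> y = z"
  proof
    assume "setdist y z = 0"
    moreover have "closed z" unfolding yz using p(2) by (rule closed_translation)
    moreover have "z \<noteq> {}" unfolding yz using p(1) by auto
    ultimately have "v \<in> z" using eq by (simp add: setdist_eq_0_sing_1)
    then obtain r where r: "r \<in> x" "v = w + r" unfolding yz by auto
    have "y \<subseteq> z"
      unfolding yz r(2) using p(3)[OF r(1)] by (auto simp: add.assoc)
    moreover have "z \<subseteq> y"
    proof
      fix q assume "q \<in> z"
      then obtain s where "s \<in> x" "q = w + s" unfolding yz by auto
      moreover from this have "s + - r \<in> x" using p r by blast
      ultimately show "q \<in> y"
        unfolding yz r(2) by (intro image_eqI[of _ _ "s + - r"]) auto
    qed
    ultimately show "y = z" by blast
  next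
    assume "y = z"
    then have "setdist {v} z = 0" using v by (simp add: setdist_sing_in_set)
    then show "setdist y z = 0" using eq by simp
  qed
  fix t assume "t \<in> grid_fibre x"
  then obtain r where t: "t = (+) r ` x"
    by (auto simp: grid_fibre_eq[OF x])
  have "w \<in> z" unfolding yz using p(1) by (intro image_eqI[of _ _ 0]) auto
  then have "setdist z y = setdist {w} y" "setdist z t = setdist {w} t"
    using setdist_translates[OF x] unfolding yz t by blast+
  then show "setdist y t \<le> setdist y z + setdist z t"
    using setdist_triangle[of y t w] by (simp add: setdist_sym)
qed

lemma torus_metric_simps:
  assumes "x \<in> unimodular_lattices"
  shows "mspace (torus_metric x) = grid_fibre x" "mdist (torus_metric x) = setdist"
  using Metric_space_grid_fibre[OF assms]
  by (simp_all add: torus_metric_def Metric_space.mspace_metric Metric_space.mdist_metric)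


section \<open>Spikes and grids meeting them finitely often\<close>

definition diag_flow :: "real^'n \<Rightarrow> real \<Rightarrow> real^'n^'n" where
  "diag_flow c t = (\<chi> i j. if i = j then exp (c $ i * t) else 0)"

definition positive_spike :: "real^'n \<Rightarrow> (real^'n) set \<Rightarrow> (real^'n) set" where
  "positive_spike c U = (\<Union>t\<in>{0<..}. (*v) (diag_flow c t) -` U)"

definition finite_grids :: "(real^'n) set \<Rightarrow> (real^'n) set \<Rightarrow> (real^'n) set set" where
  "finite_grids S x = {y \<in> grid_fibre x. finite (y \<inter> S)}"

end

theory Submission
  imports Defs
begin

text \<open>Let \<open>i0\<close> be a coordinate with \<open>c $ i0 > 0\<close> and choose in \<open>U\<close> a box that stays away from the
hyperplane \<open>v $ i0 = 0\<close>. The orbit \<open>a_t v\<close> of a single point \<open>v\<close> lies in the box only for bounded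
times, so a grid \<open>x + w\<close> with finitely many points in the spike of \<open>U\<close> has the property that
\<open>a_t (x + w)\<close> misses the box for all large \<open>t\<close>. It is enough to look at discrete times \<open>n\<tau>\<close> and
to bound, for each \<open>T\<close>, the dimension of the set of those \<open>w\<close> that avoid the box at all times
\<open>n \<ge> T\<close>; a countable union over \<open>T\<close> follows.

Cut the space into dyadic boxes such that the boxes of generation \<open>n\<close> have side comparable to
\<open>exp (- c $ j * \<tau> * n)\<close> in an expanding coordinate and constant side in a contracting one. Suppose
that every point of the space is within distance \<open>D\<close> of the lattice \<open>a_{(n+1)\<tau>} x\<close>, where \<open>\<tau>\<close> is
large in terms of \<open>D\<close>. Seen at time \<open>n + 1\<close>, a box of generation \<open>n\<close> is long in the expanding
directions, and the preimage of the target box under one further step is long in the contracting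
directions. Some lattice translate of that preimage therefore runs across the box, and hence a whole
subbox of generation \<open>n + 2\<close> consists of points that are forbidden
(\<open>box_child_in_lattice_translates\<close>). So the proportion of surviving boxes drops by a constant factor
at each such \<open>n\<close>. If these \<open>n\<close> have positive upper density, the proportion decays exponentially
along infinitely many generations (\<open>box_count_decay\<close>). Covering the boxes by cubes of the finest
side length costs nothing in volume, so infinitely many scales have a cover by too few cubes for
dimension \<open>d\<close>, and the resulting exponent depends on \<open>D\<close> and \<open>\<tau>\<close> but not on \<open>x\<close>.

It remains to see that almost every lattice returns with positive upper density to a set with a
uniform covering radius. Lattices with a basis of entries less than some constant form such a set, and
it has measure more than \<open>3/4\<close> if the constant is large. Integrating the number of visits shows that
the lattices that return with upper density at least \<open>1/2\<close> have positive measure. They form an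
invariant set, which has full measure because \<open>a_\<tau>\<close> is ergodic (\<open>diagonal_ergodic\<close>). Ergodicity is
the Mautner phenomenon: a set that is invariant under \<open>a\<close> is almost invariant under each transvection
that \<open>a\<close> contracts or expands, therefore under all of \<open>SL\<close>, which acts transitively.\<close>

section \<open>Transvections generate the special linear group\<close>

definition transvection :: "'n \<Rightarrow> 'n \<Rightarrow> real \<Rightarrow> real^'n^'n" where
  "transvection i j s = (\<chi> k l. if k = i \<and> l = j then s else of_bool (k = l))"

definition diag_matrix :: "('n \<Rightarrow> real) \<Rightarrow> real^'n^'n" where
  "diag_matrix v = (\<chi> i j. if i = j then v i else 0)"

text \<open>This is a group because the inverse of a transvection is a transvection.\<close>

inductive_set transvection_group :: "(real^'n^'n) set" where
  one: "mat 1 \<in> transvection_group"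
| gen: "i \<noteq> j \<Longrightarrow> transvection i j s \<in> transvection_group"
| mult: "A \<in> transvection_group \<Longrightarrow> B \<in> transvection_group \<Longrightarrow> A ** B \<in> transvection_group"

lemma transvection_mult:
  assumes "i \<noteq> j"
  shows "(transvection i j s ** A) $ k $ l = A $ k $ l + (if k = i then s * A $ j $ l else 0)"
proof -
  have "(transvection i j s ** A) $ k $ l = (\<Sum>m\<in>UNIV. (of_bool (m = k) + (if k = i \<and> m = j then s else 0)) * A $ m $ l)"
    using assms unfolding transvection_def matrix_matrix_mult_def
    by (auto intro!: sum.cong)
  also have "\<dots> = (\<Sum>m\<in>UNIV. (if m = k then A $ m $ l else 0)) + (\<Sum>m\<in>UNIV. if m = j then (if k = i then s * A $ m $ l else 0) else 0)"
    by (subst sum.distrib[symmetric]) (auto intro!: sum.cong simp: algebra_simps)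
  finally show ?thesis by simp
qed

lemma diag_matrix_mult: "(diag_matrix v ** A) $ k $ l = v k * A $ k $ l"
  unfolding diag_matrix_def matrix_matrix_mult_def by (simp add: if_distrib if_distribR cong: if_cong)

lemma mult_diag_matrix: "(A ** diag_matrix v) $ k $ l = A $ k $ l * v l"
  unfolding diag_matrix_def matrix_matrix_mult_def by (simp add: if_distrib if_distribR cong: if_cong)

lemma diag_matrix_mult_diag_matrix: "diag_matrix v ** diag_matrix w = diag_matrix (\<lambda>i. v i * w i)"
  by (simp add: vec_eq_iff diag_matrix_mult) (simp add: diag_matrix_def)

lemma diag_matrix_transvection:
  assumes "i \<noteq> j" "v j \<noteq> 0"
  shows "diag_matrix v ** transvection i j s = transvection i j (v i * s / v j) ** diag_matrix v"
  using assms by (auto simp: vec_eq_iff diag_matrix_mult mult_diag_matrix transvection_def)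

lemma det_diag_matrix: "det (diag_matrix v) = prod v UNIV"
  by (subst det_diagonal) (auto simp: diag_matrix_def)

lemma det_transvection: "i \<noteq> j \<Longrightarrow> det (transvection i j s) = 1"
proof -
  assume ij: "i \<noteq> j"
  have "transvection i j s = (\<chi> k. if k = i then row i (mat 1) + s *s row j (mat 1) else row k (mat 1))"
    using ij by (auto simp: vec_eq_iff transvection_def row_def mat_def)
  then show ?thesis using det_row_operation[OF ij, of "mat 1" s] by simp
qed

lemma det_transvection_group: "A \<in> transvection_group \<Longrightarrow> det A = 1"
  by (induction rule: transvection_group.induct) (auto simp: det_transvection det_mul)

lemma diag_matrix_conj_transvection_group:
  assumes "A \<in> transvection_group" "\<And>i. v i \<noteq> 0"
  shows "\<exists>B\<in>transvection_group. diag_matrix v ** A = B ** diag_matrix v"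
  using assms(1)
proof induction
  case one
  then show ?case by (intro bexI[of _ "mat 1"]) (auto intro: transvection_group.intros)
next
  case (gen i j s)
  then show ?case using diag_matrix_transvection[of i j v s] assms(2) transvection_group.gen by blast
next
  case (mult A B)
  then obtain A' B' where "A' \<in> transvection_group" "diag_matrix v ** A = A' ** diag_matrix v"
      "B' \<in> transvection_group" "diag_matrix v ** B = B' ** diag_matrix v"
    by blast
  moreover from this have "diag_matrix v ** (A ** B) = (A' ** B') ** diag_matrix v"
    by (metis matrix_mul_assoc)
  ultimately show ?case by (blast intro: transvection_group.mult)
qed

text \<open>This is the classical identity \<open>diag(r, 1/r) = w(r) w(-1)\<close> with
  \<open>w(r) = u(r) l(-1/r) u(r)\<close>, where \<open>u\<close> and \<open>l\<close> are the upper and lower transvections.\<close>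

lemma two_entry_diag_in_transvection_group:
  assumes "i \<noteq> j" "r \<noteq> 0"
  shows "diag_matrix (\<lambda>k. if k = i then r else if k = j then 1 / r else 1) \<in> transvection_group"
proof -
  let ?u = "\<lambda>s. transvection i j s" and ?l = "\<lambda>s. transvection j i s"
  have "diag_matrix (\<lambda>k. if k = i then r else if k = j then 1 / r else 1) =
     ?u r ** (?l (-1/r) ** (?u r ** (?u (-1) ** (?l 1 ** ?u (-1)))))"
    unfolding vec_eq_iff
  proof (intro allI)
    fix k l
    consider "k = i" | "k = j" | "k \<noteq> i" "k \<noteq> j" by blast
    then show "diag_matrix (\<lambda>k. if k = i then r else if k = j then 1 / r else 1) $ k $ l =
     (?u r ** (?l (-1/r) ** (?u r ** (?u (-1) ** (?l 1 ** ?u (-1)))))) $ k $ l"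
      using assms
      by cases (simp_all add: transvection_mult, simp_all add: transvection_def diag_matrix_def)
  qed
  also have "\<dots> \<in> transvection_group"
    using assms by (intro transvection_group.intros) auto
  finally show ?thesis .
qed

lemma diag_in_transvection_group_aux:
  assumes "finite F" "i0 \<notin> F" "\<And>i. i \<notin> insert i0 F \<Longrightarrow> v i = 1" "prod v UNIV = 1"
  shows "diag_matrix v \<in> transvection_group"
  using assms
proof (induction F arbitrary: v rule: finite_induct)
  case empty
  have "prod v UNIV = v i0 * prod v (UNIV - {i0})" by (rule prod.remove) auto
  also have "prod v (UNIV - {i0}) = 1" using empty by (intro prod.neutral) auto
  finally have "v = (\<lambda>_. 1)" using empty by (metis insertE empty_iff mult.right_neutral)
  then have "diag_matrix v = mat 1" by (simp add: diag_matrix_def mat_def)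
  then show ?case by (simp add: transvection_group.one)
next
  case (insert k F)
  have k: "k \<noteq> i0" using insert by auto
  have nz: "v i \<noteq> 0" for i using \<open>prod v UNIV = 1\<close> by (metis finite UNIV_I prod_zero zero_neq_one)
  define h where "h = (\<lambda>l. if l = k then v k else if l = i0 then 1 / v k else 1)"
  define v' where "v' = (\<lambda>l. v l / h l)"
  have hh: "prod h UNIV = 1"
  proof -
    have "prod h UNIV = prod h {k, i0}" by (rule prod.mono_neutral_right) (auto simp: h_def)
    then show ?thesis using k nz by (simp add: h_def)
  qed
  have "diag_matrix v' \<in> transvection_group"
  proof (rule insert.IH)
    show "i0 \<notin> F" using insert by auto
    show "prod v' UNIV = 1" unfolding v'_def by (simp add: prod_dividef hh insert.prems)
    fix i assume "i \<notin> Set.insert i0 F" then show "v' i = 1"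
      using insert.prems(2)[of i] nz unfolding v'_def h_def by auto
  qed
  moreover have "diag_matrix v = diag_matrix h ** diag_matrix v'"
    unfolding diag_matrix_mult_diag_matrix v'_def using nz by (auto simp: h_def fun_eq_iff intro!: arg_cong[where f=diag_matrix])
  moreover have "diag_matrix h \<in> transvection_group" unfolding h_def
    by (rule two_entry_diag_in_transvection_group[OF k nz])
  ultimately show ?case by (simp add: transvection_group.mult)
qed

lemma diag_in_transvection_group:
  assumes "prod v UNIV = 1"
  shows "diag_matrix v \<in> transvection_group"
  by (rule diag_in_transvection_group_aux[of "UNIV - {i0}" i0]) (use assms in auto)

text \<open>Gaussian elimination, in the form of induction over elementary matrices. Products are handled by
  moving a diagonal factor past a transvection, which only rescales the transvection, and a swap of two
  coordinates is a product of three transvections up to one sign.\<close>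

lemma transvection_diag_decomposition:
  fixes A :: "real^'n^'n"
  shows "det A \<noteq> 0 \<longrightarrow> (\<exists>T\<in>transvection_group. \<exists>v. (\<forall>i. v i \<noteq> 0) \<and> A = T ** diag_matrix v)"
proof (induction A rule: induct_matrix_elementary)
  case (1 A B)
  show ?case
  proof
    assume "det (A ** B) \<noteq> 0"
    then have "det A \<noteq> 0" "det B \<noteq> 0" by (auto simp: det_mul)
    with 1 have "\<exists>T\<in>transvection_group. \<exists>v. (\<forall>i. v i \<noteq> 0) \<and> A = T ** diag_matrix v"
      "\<exists>T\<in>transvection_group. \<exists>v. (\<forall>i. v i \<noteq> 0) \<and> B = T ** diag_matrix v"
      by simp_all
    then obtain T v T' v' where *: "T \<in> transvection_group" "\<forall>i. v i \<noteq> 0" "A = T ** diag_matrix v"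
      "T' \<in> transvection_group" "\<forall>i. v' i \<noteq> 0" "B = T' ** diag_matrix v'"
      by (elim bexE exE conjE) (rule that)
    obtain T'' where T'': "T'' \<in> transvection_group" "diag_matrix v ** T' = T'' ** diag_matrix v"
      using diag_matrix_conj_transvection_group[of T' v] *(2,4) by metis
    have "A ** B = (T ** T'') ** diag_matrix (\<lambda>i. v i * v' i)"
    proof -
      have "A ** B = T ** ((diag_matrix v ** T') ** diag_matrix v')"
        by (simp add: *(3,6) matrix_mul_assoc)
      also have "\<dots> = (T ** T'') ** (diag_matrix v ** diag_matrix v')"
        by (simp add: T''(2) matrix_mul_assoc)
      finally show ?thesis by (simp add: diag_matrix_mult_diag_matrix)
    qed
    then show "\<exists>T\<in>transvection_group. \<exists>v. (\<forall>i. v i \<noteq> 0) \<and> A ** B = T ** diag_matrix v"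
      using *(1,2,5) T''(1) by (intro bexI[of _ "T ** T''"] exI[of _ "\<lambda>i. v i * v' i"]) (simp_all add: transvection_group.mult)
  qed
next
  case (2 A i)
  then show ?case using det_zero_row by auto
next
  case (3 A)
  have "A = mat 1 ** diag_matrix (\<lambda>i. A $ i $ i)"
    using 3 by (auto simp: vec_eq_iff diag_matrix_def)
  moreover have "det A = (\<Prod>i\<in>UNIV. A $ i $ i)" using 3 by (rule det_diagonal)
  ultimately show ?case
    by (intro impI bexI[OF _ transvection_group.one] exI[of _ "\<lambda>i. A $ i $ i"]) simp
next
  case (4 m n)
  let ?v = "(\<lambda>k. if k = n then -1 else 1) :: 'n \<Rightarrow> real"
  have "(\<chi> i j. mat 1 $ i $ Transposition.transpose m n j) = 
     (transvection n m 1 ** (transvection m n (-1) ** transvection n m 1)) ** diag_matrix (\<lambda>k. if k = n then -1 else 1)"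
    unfolding vec_eq_iff mult_diag_matrix
  proof (intro allI)
    fix k l
    consider "k = m" | "k = n" | "k \<noteq> m" "k \<noteq> n" by blast
    then show "(\<chi> i j. mat 1 $ i $ Transposition.transpose m n j) $ k $ l =
      (transvection n m 1 ** (transvection m n (-1) ** transvection n m 1)) $ k $ l * (if l = n then - 1 else 1)"
      using 4
      by cases (simp_all add: transvection_mult, auto simp: transvection_def mat_def Transposition.transpose_def)
  qed
  then show ?case using 4
    by (intro impI bexI[of _ "transvection n m 1 ** (transvection m n (-1) ** transvection n m 1)"] exI[of _ "\<lambda>k. if k = n then -1 else 1"])
      (auto intro!: transvection_group.intros)
next
  case (5 m n c)
  then show ?case
    by (intro impI bexI[of _ "transvection m n c"] exI[of _ "\<lambda>_. 1"])
      (auto intro!: transvection_group.intros simp: vec_eq_iff mult_diag_matrix, auto simp: transvection_def)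
qed

text \<open>In the decomposition of a matrix of determinant 1 the diagonal factor also has determinant 1, so its
  entries can be cleared one by one into a chosen position \<open>i0\<close> by the two-entry diagonal matrices.\<close>

theorem transvection_group_eq_SL: "transvection_group = SL"
proof
  show "transvection_group \<subseteq> SL" by (auto simp: SL_def det_transvection_group)
  show "SL \<subseteq> transvection_group"
  proof
    fix A :: "real^'n^'n" assume "A \<in> SL"
    then have d: "det A = 1" by (simp add: SL_def)
    then obtain T v where *: "T \<in> transvection_group" "\<And>i. v i \<noteq> 0" "A = T ** diag_matrix v"
      using transvection_diag_decomposition[of A] by auto
    then have "prod v UNIV = 1" using d by (simp add: det_mul det_transvection_group det_diag_matrix)
    then show "A \<in> transvection_group"
      using * diag_in_transvection_group transvection_group.mult by blast
  qed
qed

section \<open>The action on the space of lattices\<close>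

abbreviation act :: "real^'n^'n \<Rightarrow> (real^'n) set \<Rightarrow> (real^'n) set" where
  "act g x \<equiv> (*v) g ` x"

lemma act_act: "act g (act h x) = act (g ** h) x"
  by (simp add: image_image matrix_vector_mul_assoc)

lemma act_one: "act (mat 1) x = x"
  by simp

lemma SL_one: "mat 1 \<in> SL"
  by (simp add: SL_def)

lemma SL_mult: "g \<in> SL \<Longrightarrow> h \<in> SL \<Longrightarrow> g ** h \<in> SL"
  by (simp add: SL_def det_mul)

lemma SL_inverse:
  assumes "g \<in> SL"
  obtains h where "h \<in> SL" "g ** h = mat 1" "h ** g = mat 1"
proof -
  have "invertible g" using assms by (simp add: SL_def invertible_det_nz)
  then obtain h where h: "g ** h = mat 1" "h ** g = mat 1" unfolding invertible_def by blast
  have "det g * det h = 1" using h(1) by (metis det_mul det_I)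
  then have "h \<in> SL" using assms by (simp add: SL_def)
  with h show ?thesis using that by blast
qed

lemma lattice_of_mult: "lattice_of (g ** h) = act g (lattice_of h)"
  by (simp add: lattice_of_def image_image matrix_vector_mul_assoc)

lemma lattice_of_in: "g \<in> SL \<Longrightarrow> lattice_of g \<in> unimodular_lattices"
  by (simp add: unimodular_lattices_def)

lemma act_unimodular: "g \<in> SL \<Longrightarrow> x \<in> unimodular_lattices \<Longrightarrow> act g x \<in> unimodular_lattices"
  by (auto simp: unimodular_lattices_def SL_mult simp flip: lattice_of_mult)

lemma continuous_on_matrix_mult [continuous_intros]:
  fixes f g :: "'a::topological_space \<Rightarrow> real^'n^'n"
  assumes "continuous_on S f" "continuous_on S g"
  shows "continuous_on S (\<lambda>x. f x ** g x)"
  unfolding matrix_matrix_mult_def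
  by (intro continuous_intros continuous_on_sum assms)

text \<open>Two matrices give the same lattice iff they differ by a right factor from the stabilizer of the
  integer lattice. So the preimage of the image of \<open>B\<close> is a union of translates of \<open>B\<close>.\<close>

lemma lattice_of_open_map:
  fixes B :: "(real^'n^'n) set"
  assumes "open B"
  shows "openin lattice_topology (lattice_of ` (B \<inter> SL))"
proof -
  let ?\<Gamma> = "{\<gamma>\<in>SL. lattice_of \<gamma> = (int_lattice :: (real^'n) set)}"
  have "{g \<in> SL. lattice_of g \<in> lattice_of ` (B \<inter> SL)} = SL \<inter> (\<Union>\<gamma>\<in>?\<Gamma>. (\<lambda>g. g ** \<gamma>) -` B)" (is "?L = ?R")
  proof (intro equalityI subsetI)
    fix g assume "g \<in> ?L"
    then obtain h where h: "g \<in> SL" "h \<in> B" "h \<in> SL" "lattice_of g = lattice_of h" by auto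
    obtain k where k: "k \<in> SL" "g ** k = mat 1" "k ** g = mat 1" using SL_inverse[OF h(1)] by blast
    have "lattice_of (k ** h) = lattice_of (k ** g)" by (simp add: lattice_of_mult h(4))
    also have "\<dots> = int_lattice" by (simp add: k lattice_of_def)
    finally have "k ** h \<in> ?\<Gamma>" using k h by (simp add: SL_mult)
    moreover have "g ** (k ** h) = h" by (simp add: matrix_mul_assoc k)
    ultimately show "g \<in> ?R" using h by force
  next
    fix g assume "g \<in> ?R"
    then obtain \<gamma> where "g \<in> SL" "\<gamma> \<in> SL" "lattice_of \<gamma> = int_lattice" "g ** \<gamma> \<in> B" by auto
    moreover from this have "lattice_of g = lattice_of (g ** \<gamma>)"
      by (simp add: lattice_of_mult) (simp add: lattice_of_def)
    ultimately show "g \<in> ?L" by (auto simp: SL_mult)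
  qed
  moreover have "open (\<Union>\<gamma>\<in>?\<Gamma>. (\<lambda>g. g ** \<gamma>) -` B)"
    by (intro open_UN ballI open_vimage assms continuous_intros)
  ultimately show ?thesis
    unfolding openin_lattice_topology
    by (auto simp: lattice_of_in openin_open)
qed

locale lattice_measure =
  fixes m :: "(real^'n) set measure"
  assumes invariant: "invariant_lattice_measure m"

sublocale lattice_measure \<subseteq> prob_space m
  using invariant by (simp add: invariant_lattice_measure_def)

context lattice_measure
begin

lemma space_m: "space m = unimodular_lattices"
  and sets_m: "sets m = sigma_sets unimodular_lattices {V. openin lattice_topology V}"
  using invariant by (simp_all add: invariant_lattice_measure_def)

lemma openin_sets: "openin lattice_topology V \<Longrightarrow> V \<in> sets m"
  unfolding sets_m by auto

text \<open>The preimage of an open set is open in the product topology, but has to be in the product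
  sigma-algebra, for which a countable union of rectangles is needed. Pull back to \<open>SL \<times> SL\<close>, which is second countable, and push the second factors of
  basic rectangles forward by the open map \<open>lattice_of\<close>.\<close>

lemma act_measurable: "(\<lambda>(g, x). act g x) \<in> restrict_space borel SL \<Otimes>\<^sub>M m \<rightarrow>\<^sub>M m"
proof (rule measurable_sigma_sets[OF sets_m])
  show "{V. openin lattice_topology V} \<subseteq> Pow (unimodular_lattices :: (real^'n) set set)"
    by (auto simp: openin_lattice_topology)
  show "(\<lambda>(g, x). act g x) \<in> space (restrict_space borel SL \<Otimes>\<^sub>M m) \<rightarrow> unimodular_lattices"
    by (auto simp: space_pair_measure space_m space_restrict_space act_unimodular)
next
  fix V :: "(real^'n) set set"
  assume "V \<in> {V. openin lattice_topology V}"
  then have "openin (top_of_set SL) {g \<in> SL. lattice_of g \<in> V}"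
    by (simp add: openin_lattice_topology)
  then obtain O' where O': "open O'" "{g \<in> SL. lattice_of g \<in> V} = SL \<inter> O'"
    by (auto simp: openin_open)
  have O'': "lattice_of g \<in> V \<longleftrightarrow> g \<in> O'" if "g \<in> SL" for g using O'(2) that by blast
  obtain B :: "(real^'n^'n) set set" where B: "countable B" "topological_basis B"
    using ex_countable_basis by blast
  define P where "P = {(b1, b2) \<in> B \<times> B. \<forall>g\<in>b1 \<inter> SL. \<forall>h\<in>b2 \<inter> SL. lattice_of (g ** h) \<in> V}"
  have "(\<lambda>(g, x). act g x) -` V \<inter> space (restrict_space borel SL \<Otimes>\<^sub>M m) =
     (\<Union>p\<in>P. (fst p \<inter> SL) \<times> lattice_of ` (snd p \<inter> SL))" (is "?L = ?R")
  proof (intro equalityI subsetI)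
    fix z assume "z \<in> ?L"
    then obtain g x where z: "z = (g, x)" "g \<in> SL" "x \<in> unimodular_lattices" "act g x \<in> V"
      by (auto simp: space_pair_measure space_m space_restrict_space)
    then obtain h where h: "h \<in> SL" "x = lattice_of h" by (auto simp: unimodular_lattices_def)
    have "g ** h \<in> O'" using O''[of "g ** h"] z h by (simp add: SL_mult lattice_of_mult)
    define W where "W = (\<lambda>p::(real^'n^'n) \<times> (real^'n^'n). fst p ** snd p) -` O'"
    have "open W" unfolding W_def by (intro open_vimage O' continuous_intros)
    moreover have "(g, h) \<in> W" using \<open>g ** h \<in> O'\<close> by (simp add: W_def)
    ultimately obtain U1 U2 where U: "open U1" "open U2" "(g, h) \<in> U1 \<times> U2" "U1 \<times> U2 \<subseteq> W"
      by (rule open_prod_elim)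
    have gU: "g \<in> U1" "h \<in> U2" using U(3) by auto
    obtain b1 where b1: "b1 \<in> B" "g \<in> b1" "b1 \<subseteq> U1" using topological_basisE[OF B(2) U(1) gU(1)] by blast
    obtain b2 where b2: "b2 \<in> B" "h \<in> b2" "b2 \<subseteq> U2" using topological_basisE[OF B(2) U(2) gU(2)] by blast
    have "(b1, b2) \<in> P" unfolding P_def
    proof (clarsimp, intro conjI ballI)
      show "b1 \<in> B" "b2 \<in> B" by fact+
      fix g' h' assume "g' \<in> b1 \<inter> SL" "h' \<in> b2 \<inter> SL"
      moreover from this have "(g', h') \<in> W" using b1(3) b2(3) U(4) by blast
      then have "g' ** h' \<in> O'" by (simp add: W_def)
      ultimately show "lattice_of (g' ** h') \<in> V" using O'' by (simp add: SL_mult)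
    qed
    then show "z \<in> ?R" using b1 b2 z h by force
  next
    fix z assume "z \<in> ?R"
    then show "z \<in> ?L"
      by (auto simp: P_def space_pair_measure space_m space_restrict_space lattice_of_in lattice_of_mult)
  qed
  also have "\<dots> \<in> sets (restrict_space borel SL \<Otimes>\<^sub>M m)"
  proof (rule sets.countable_UN'')
    have "P \<subseteq> B \<times> B" by (auto simp: P_def)
    then show "countable P" using B(1) by (metis countable_SIGMA countable_subset)
    fix p assume "p \<in> P"
    then have "open (fst p)" "open (snd p)"
      using topological_basis_open[OF B(2)] by (auto simp: P_def)
    have "fst p \<inter> SL \<in> sets (restrict_space borel SL)"
      unfolding sets_restrict_space using \<open>open (fst p)\<close> by (intro image_eqI[of _ _ "fst p"]) auto
    then show "(fst p \<inter> SL) \<times> lattice_of ` (snd p \<inter> SL) \<in> sets (restrict_space borel SL \<Otimes>\<^sub>M m)"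
      using \<open>open (snd p)\<close> by (intro pair_measureI openin_sets lattice_of_open_map)
  qed
  finally show "(\<lambda>(g, x). act g x) -` V \<inter> space (restrict_space borel SL \<Otimes>\<^sub>M m) \<in> sets (restrict_space borel SL \<Otimes>\<^sub>M m)" .
qed

lemma act_measurable_compose:
  assumes "g \<in> borel_measurable M" "\<And>s. s \<in> space M \<Longrightarrow> g s \<in> SL"
  shows "(\<lambda>p. act (g (fst p)) (snd p)) \<in> M \<Otimes>\<^sub>M m \<rightarrow>\<^sub>M m"
proof -
  have "(\<lambda>p. (g (fst p), snd p)) \<in> M \<Otimes>\<^sub>M m \<rightarrow>\<^sub>M restrict_space borel SL \<Otimes>\<^sub>M m"
    using assms by (intro measurable_Pair measurable_restrict_space2) (auto simp: space_pair_measure)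
  from measurable_compose[OF this act_measurable] show ?thesis by simp
qed

lemma act_measurable_single [measurable]:
  assumes "g \<in> SL" shows "act g \<in> m \<rightarrow>\<^sub>M m"
proof -
  have "(\<lambda>x. (g, x)) \<in> m \<rightarrow>\<^sub>M restrict_space borel SL \<Otimes>\<^sub>M m"
    using assms by (intro measurable_Pair measurable_restrict_space2) auto
  from measurable_compose[OF this act_measurable] show ?thesis by simp
qed

lemma emeasure_act_preimage:
  assumes "g \<in> SL" "A \<in> sets m"
  shows "emeasure m {x \<in> space m. act g x \<in> A} = emeasure m A"
proof -
  obtain h where h: "h \<in> SL" "g ** h = mat 1" "h ** g = mat 1" using SL_inverse[OF assms(1)] by blast
  have "A \<subseteq> space m" using assms(2) by (rule sets.sets_into_space)
  have *: "\<forall>x. act h (act g x) = x" "\<forall>x. act g (act h x) = x"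
    unfolding act_act h act_one by simp_all
  have "{x \<in> space m. G x \<in> A} = H ` A"
    if "\<forall>x. H (G x) = x" "\<forall>x. G (H x) = x" "\<forall>x\<in>space m. H x \<in> space m"
    for G H :: "(real^'n) set \<Rightarrow> (real^'n) set"
  proof (intro equalityI subsetI)
    fix x assume "x \<in> {x \<in> space m. G x \<in> A}"
    then show "x \<in> H ` A" using that(1) by (metis (mono_tags, lifting) imageI mem_Collect_eq)
  next
    fix x assume "x \<in> H ` A"
    then obtain y where y: "y \<in> A" "x = H y" by blast
    then show "x \<in> {x \<in> space m. G x \<in> A}" using that(2,3) \<open>A \<subseteq> space m\<close> by auto
  qed
  moreover have "\<forall>x\<in>space m. act h x \<in> space m"
    using act_unimodular[OF h(1)] by (simp add: space_m)
  ultimately have "{x \<in> space m. act g x \<in> A} = act h ` A"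
    using * by blast
  then show ?thesis using invariant h(1) assms(2) unfolding invariant_lattice_measure_def by simp
qed

lemma distr_act: "g \<in> SL \<Longrightarrow> distr m m (act g) = m"
proof (rule measure_eqI)
  fix A assume g: "g \<in> SL" and "A \<in> sets (distr m m (act g))"
  then have A: "A \<in> sets m" by simp
  have "act g -` A \<inter> space m = {x \<in> space m. act g x \<in> A}" by blast
  then show "emeasure (distr m m (act g)) A = emeasure m A"
    by (simp add: emeasure_distr act_measurable_single[OF g] A emeasure_act_preimage[OF g A])
qed simp

end

section \<open>Continuity of one-parameter orbits in measure\<close>

text \<open>Squeeze \<open>S\<close> on a bounded interval between a compact set \<open>C\<close> and an open set \<open>G\<close> with \<open>G - C\<close> of small
  measure. A translation by less than the distance of \<open>C\<close> from the complement of \<open>G\<close> moves \<open>C\<close> inside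
  \<open>G\<close>, so a point can change its membership only if it or its translate lies in \<open>G - C\<close>.\<close>

lemma translation_continuous_in_measure:
  fixes S :: "real set"
  assumes S: "S \<in> sets borel" and "\<eta> > 0"
  shows "\<exists>\<delta>>0. \<forall>h. \<bar>h\<bar> < \<delta> \<longrightarrow>
    emeasure lborel {s \<in> {0..1}. (s + h \<in> S) \<noteq> (s \<in> S)} \<le> ennreal \<eta>"
proof -
  define T where "T = S \<inter> {-1..2}"
  have T: "T \<in> sets borel" "T \<in> sets lebesgue" using S by (auto simp: T_def)
  obtain G where G: "open G" "T \<subseteq> G" "(G - T) \<in> lmeasurable" "emeasure lebesgue (G - T) < ennreal (\<eta>/4)"
    using sets_lebesgue_outer_open[OF T(2), of "\<eta>/4"] \<open>\<eta> > 0\<close> by auto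
  obtain C where C: "closed C" "C \<subseteq> T" "(T - C) \<in> lmeasurable" "emeasure lebesgue (T - C) < ennreal (\<eta>/4)"
    using sets_lebesgue_inner_closed[OF T(2), of "\<eta>/4"] \<open>\<eta> > 0\<close> by auto
  have "bounded C" using C(2) unfolding T_def by (meson bounded_closed_interval bounded_subset inf.boundedE)
  then have "compact C" using C(1) by (simp add: compact_eq_bounded_closed)
  moreover have "C \<subseteq> G" using C(2) G(2) by simp
  ultimately obtain d where d: "d > 0" "(\<Union>x\<in>C. ball x d) \<subseteq> G"
    using compact_subset_open_imp_ball_epsilon_subset[of C G] G(1) by metis
  have CT: "C \<in> sets borel" "G \<in> sets borel" using C(1) G(1) by auto
  have "emeasure lborel (G - C) = emeasure lborel ((G - T) \<union> (T - C))"
    using C(2) G(2) by (intro arg_cong[where f = "emeasure lborel"]) blast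
  also have "\<dots> \<le> emeasure lborel (G - T) + emeasure lborel (T - C)"
    using T CT by (intro emeasure_subadditive) auto
  also have "\<dots> \<le> ennreal (\<eta>/4) + ennreal (\<eta>/4)"
    using C(4) G(4) T(1) CT by (intro add_mono) (simp_all add: emeasure_completion)
  also have "\<dots> = ennreal (\<eta>/2)" using \<open>\<eta> > 0\<close> by (subst ennreal_plus[symmetric]) auto
  finally have GC: "emeasure lborel (G - C) \<le> ennreal (\<eta>/2)" .
  show ?thesis
  proof (intro exI[of _ "min d 1"] conjI allI impI)
    show "0 < min d 1" using d by simp
    fix h :: real assume h: "\<bar>h\<bar> < min d 1"
    have VM: "(\<lambda>s. h + s) -` (G - C) \<in> sets borel"
      using CT by (intro measurable_sets_borel[of "\<lambda>s. h + s" borel]) auto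
    have "{s \<in> {0..1}. (s + h \<in> S) \<noteq> (s \<in> S)} \<subseteq> (G - C) \<union> ((\<lambda>s. h + s) -` (G - C))"
    proof
      fix s assume s: "s \<in> {s \<in> {0..1}. (s + h \<in> S) \<noteq> (s \<in> S)}"
      then have ne: "(s + h \<in> T) \<noteq> (s \<in> T)" using h by (auto simp: T_def)
      have near: "b \<in> G" if "a \<in> C" "\<bar>a - b\<bar> < d" for a b
        using that d(2) by (auto simp: subset_iff dist_real_def)
      show "s \<in> (G - C) \<union> ((\<lambda>s. h + s) -` (G - C))"
        using ne near[of s "s + h"] near[of "s + h" s] h C(2) G(2) by (auto simp: add.commute)
    qed
    then have "emeasure lborel {s \<in> {0..1}. (s + h \<in> S) \<noteq> (s \<in> S)} \<le> emeasure lborel ((G - C) \<union> ((\<lambda>s. h + s) -` (G - C)))"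
      using CT VM by (intro emeasure_mono) simp_all
    also have "\<dots> \<le> emeasure lborel (G - C) + emeasure lborel ((\<lambda>s. h + s) -` (G - C))"
      using CT VM by (intro emeasure_subadditive) auto
    also have "emeasure lborel ((\<lambda>s. h + s) -` (G - C)) = emeasure (distr lborel borel ((+) h)) (G - C)"
      using CT by (subst emeasure_distr) auto
    also have "\<dots> = emeasure lborel (G - C)" by (simp only: lborel_distr_plus)
    also have "emeasure lborel (G - C) + emeasure lborel (G - C) \<le> ennreal (\<eta>/2) + ennreal (\<eta>/2)"
      using GC by (intro add_mono)
    also have "\<dots> = ennreal \<eta>" using \<open>\<eta> > 0\<close> by (subst ennreal_plus[symmetric]) auto
    finally show "emeasure lborel {s \<in> {0..1}. (s + h \<in> S) \<noteq> (s \<in> S)} \<le> ennreal \<eta>" .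
  qed
qed

context lattice_measure
begin

definition displaced :: "(real^'n) set set \<Rightarrow> real^'n^'n \<Rightarrow> ennreal" where
  "displaced E g = emeasure m {x \<in> space m. (act g x \<in> E) \<noteq> (x \<in> E)}"

definition ae_invariant :: "(real^'n) set set \<Rightarrow> real^'n^'n \<Rightarrow> bool" where
  "ae_invariant E g \<longleftrightarrow> g \<in> SL \<and> (AE x in m. (act g x \<in> E) = (x \<in> E))"

lemma displaced_sets:
  assumes "E \<in> sets m" "g \<in> SL"
  shows "{x \<in> space m. (act g x \<in> E) \<noteq> (x \<in> E)} \<in> sets m"
proof -
  note [measurable] = assms(1) act_measurable_single[OF assms(2)]
  show ?thesis by measurable
qed

text \<open>By invariance of the measure the displacement under \<open>u h\<close> is unchanged when the points are first moved
  by \<open>u s\<close>. Averaging over \<open>0 \<le> s \<le> 1\<close> and exchanging the integrals turns it into the integral over \<open>x\<close>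
  of the displacement under translation by \<open>h\<close> of the Borel set of times at which the orbit of \<open>x\<close> is in
  \<open>E\<close>, and that tends to 0 for each \<open>x\<close> separately.\<close>

lemma displaced_tendsto_0:
  fixes u :: "real \<Rightarrow> real^'n^'n"
  assumes E: "E \<in> sets m"
    and u: "\<And>s. u s \<in> SL" "u \<in> borel_measurable borel" "\<And>s t. u (s + t) = u s ** u t"
    and e: "e \<longlonglongrightarrow> 0"
  shows "(\<lambda>n. displaced E (u (e n))) \<longlonglongrightarrow> 0"
proof -
  interpret L: pair_sigma_finite lborel m ..
  define S where "S x = {s. act (u s) x \<in> E}" for x
  have acts: "(\<lambda>p. act (u (g (fst p))) (snd p)) \<in> lborel \<Otimes>\<^sub>M m \<rightarrow>\<^sub>M m" if "g \<in> borel_measurable borel" for g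
    using act_measurable_compose[of "\<lambda>s. u (g s)" lborel] u(1,2) measurable_compose[OF that u(2)] by simp
  have S_meas: "S x \<in> sets borel" if "x \<in> space m" for x
  proof -
    have "(\<lambda>s. act (u s) x) \<in> lborel \<rightarrow>\<^sub>M m"
      using measurable_compose[OF measurable_Pair2'[OF that, of lborel] acts[of "\<lambda>s. s", OF measurable_ident_sets[OF refl]]] by simp
    from measurable_sets[OF this E] show ?thesis by (simp add: S_def vimage_def)
  qed
  \<comment> \<open>The integrand of the double integral, as a function of the pair \<open>(s, x)\<close>.\<close>
  define f where "f h p = (indicator {0..1} (fst p) * indicator {p. (act (u (fst p + h)) (snd p) \<in> E) \<noteq> (act (u (fst p)) (snd p) \<in> E)} p :: ennreal)" for h p
  have f_meas: "f h \<in> borel_measurable (lborel \<Otimes>\<^sub>M m)" for h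
  proof -
    have [measurable]: "(\<lambda>p. act (u (fst p + h)) (snd p)) \<in> lborel \<Otimes>\<^sub>M m \<rightarrow>\<^sub>M m"
      "(\<lambda>p. act (u (fst p)) (snd p)) \<in> lborel \<Otimes>\<^sub>M m \<rightarrow>\<^sub>M m"
      by (intro acts; measurable)+
    note [measurable] = E
    show ?thesis unfolding f_def by measurable
  qed
  have eq: "displaced E (u h) = (\<integral>\<^sup>+x. emeasure lborel {s \<in> {0..1}. (s + h \<in> S x) \<noteq> (s \<in> S x)} \<partial>m)" for h
  proof -
    have "displaced E (u h) = (\<integral>\<^sup>+s. displaced E (u h) * indicator {0..1::real} s \<partial>lborel)"
      by (subst nn_integral_cmult_indicator) auto
    also have "\<dots> = (\<integral>\<^sup>+s. (\<integral>\<^sup>+x. f h (s, x) \<partial>m) \<partial>lborel)"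
    proof (rule nn_integral_cong)
      fix s :: real
      have "displaced E (u h) = emeasure m {x \<in> space m. act (u s) x \<in> {x \<in> space m. (act (u h) x \<in> E) \<noteq> (x \<in> E)}}"
        unfolding displaced_def by (rule emeasure_act_preimage[symmetric]) (use displaced_sets[OF E] u in auto)
      also have "{x \<in> space m. act (u s) x \<in> {x \<in> space m. (act (u h) x \<in> E) \<noteq> (x \<in> E)}} = {x \<in> space m. (act (u (s + h)) x \<in> E) \<noteq> (act (u s) x \<in> E)}"
      proof -
        have 1: "act (u h) (act (u s) x) = act (u (s + h)) x" for x
          unfolding act_act u(3)[symmetric] by (simp add: add.commute)
        have 2: "act (u s) x \<in> space m" if "x \<in> space m" for x
          using that act_unimodular[OF u(1)] by (simp add: space_m)
        show ?thesis
        proof (intro Collect_cong conj_cong refl)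
          fix x assume "x \<in> space m"
          from 2[OF this] show "(act (u s) x \<in> {x \<in> space m. (act (u h) x \<in> E) \<noteq> (x \<in> E)}) =
             ((act (u (s + h)) x \<in> E) \<noteq> (act (u s) x \<in> E))"
            by (simp only: mem_Collect_eq simp_thms 1)
        qed
      qed
      finally have *: "displaced E (u h) = emeasure m {x \<in> space m. (act (u (s + h)) x \<in> E) \<noteq> (act (u s) x \<in> E)}" .
      have "(\<integral>\<^sup>+x. f h (s, x) \<partial>m) = (\<integral>\<^sup>+x. indicator {0..1} s * indicator {x \<in> space m. (act (u (s + h)) x \<in> E) \<noteq> (act (u s) x \<in> E)} x \<partial>m)"
        by (rule nn_integral_cong) (auto simp: f_def indicator_def)
      also have "\<dots> = indicator {0..1} s * displaced E (u h)"
      proof -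
        note [measurable] = act_measurable_single[OF u(1)] E
        show ?thesis unfolding * by (subst nn_integral_cmult) (auto simp: nn_integral_indicator)
      qed
      finally show "displaced E (u h) * indicator {0..1} s = (\<integral>\<^sup>+x. f h (s, x) \<partial>m)" by (simp add: mult.commute)
    qed
    also have "\<dots> = (\<integral>\<^sup>+x. (\<integral>\<^sup>+s. f h (s, x) \<partial>lborel) \<partial>m)"
      using L.Fubini[OF f_meas[of h]] by simp
    also have "\<dots> = (\<integral>\<^sup>+x. emeasure lborel {s \<in> {0..1}. (s + h \<in> S x) \<noteq> (s \<in> S x)} \<partial>m)"
    proof (rule nn_integral_cong)
      fix x assume x: "x \<in> space m"
      have "{s \<in> {0..1}. (s + h \<in> S x) \<noteq> (s \<in> S x)} \<in> sets borel"
      proof -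
        note [measurable] = S_meas[OF x]
        show ?thesis by measurable
      qed
      moreover have "(\<integral>\<^sup>+s. f h (s, x) \<partial>lborel) = (\<integral>\<^sup>+s. indicator {s \<in> {0..1}. (s + h \<in> S x) \<noteq> (s \<in> S x)} s \<partial>lborel)"
        by (rule nn_integral_cong) (auto simp: f_def S_def indicator_def)
      ultimately show "(\<integral>\<^sup>+s. f h (s, x) \<partial>lborel) = emeasure lborel {s \<in> {0..1}. (s + h \<in> S x) \<noteq> (s \<in> S x)}"
        by simp
    qed
    finally show ?thesis .
  qed
  have int_meas: "(\<lambda>x. emeasure lborel {s \<in> {0..1}. (s + h \<in> S x) \<noteq> (s \<in> S x)}) \<in> borel_measurable m" for h
  proof -
    have "(\<lambda>x. (\<integral>\<^sup>+s. f h (s, x) \<partial>lborel)) \<in> borel_measurable m"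
      using f_meas[of h] by measurable
    moreover have "(\<integral>\<^sup>+s. f h (s, x) \<partial>lborel) = emeasure lborel {s \<in> {0..1}. (s + h \<in> S x) \<noteq> (s \<in> S x)}" if x: "x \<in> space m" for x
    proof -
      have "{s \<in> {0..1}. (s + h \<in> S x) \<noteq> (s \<in> S x)} \<in> sets borel"
      proof -
        note [measurable] = S_meas[OF x]
        show ?thesis by measurable
      qed
      moreover have "(\<integral>\<^sup>+s. f h (s, x) \<partial>lborel) = (\<integral>\<^sup>+s. indicator {s \<in> {0..1}. (s + h \<in> S x) \<noteq> (s \<in> S x)} s \<partial>lborel)"
        by (rule nn_integral_cong) (auto simp: f_def S_def indicator_def)
      ultimately show ?thesis by simp
    qed
    ultimately show ?thesis by (simp cong: measurable_cong)
  qed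
  have "(\<lambda>n. \<integral>\<^sup>+x. emeasure lborel {s \<in> {0..1}. (s + e n \<in> S x) \<noteq> (s \<in> S x)} \<partial>m) \<longlonglongrightarrow> (\<integral>\<^sup>+x. 0 \<partial>m)"
  proof (rule nn_integral_dominated_convergence[where w = "\<lambda>_. 1"])
    show "AE x in m. emeasure lborel {s \<in> {0..1}. (s + e n \<in> S x) \<noteq> (s \<in> S x)} \<le> 1" for n
    proof (rule AE_I2)
      fix x
      have "emeasure lborel {s \<in> {0..1}. (s + e n \<in> S x) \<noteq> (s \<in> S x)} \<le> emeasure lborel {0..1::real}"
        by (intro emeasure_mono) auto
      then show "emeasure lborel {s \<in> {0..1}. (s + e n \<in> S x) \<noteq> (s \<in> S x)} \<le> 1" by simp
    qed
    show "AE x in m. (\<lambda>n. emeasure lborel {s \<in> {0..1}. (s + e n \<in> S x) \<noteq> (s \<in> S x)}) \<longlonglongrightarrow> 0"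
    proof (rule AE_I2)
      fix x assume x: "x \<in> space m"
      show "(\<lambda>n. emeasure lborel {s \<in> {0..1}. (s + e n \<in> S x) \<noteq> (s \<in> S x)}) \<longlonglongrightarrow> 0"
      proof (rule order_tendstoI)
        fix a :: ennreal assume "0 < a"
        then obtain \<eta> where \<eta>: "0 < \<eta>" "\<eta> < a" using dense by blast
        then obtain r where r: "\<eta> = ennreal r" "r > 0"
          by (cases \<eta>) auto
        obtain \<delta> where \<delta>: "\<delta> > 0" "\<forall>h. \<bar>h\<bar> < \<delta> \<longrightarrow> emeasure lborel {s \<in> {0..1}. (s + h \<in> S x) \<noteq> (s \<in> S x)} \<le> ennreal r"
          using translation_continuous_in_measure[OF S_meas[OF x] r(2)] by blast
        have "eventually (\<lambda>n. \<bar>e n\<bar> < \<delta>) sequentially"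
          using tendstoD[OF e \<delta>(1)] by (simp add: dist_real_def)
        then show "eventually (\<lambda>n. emeasure lborel {s \<in> {0..1}. (s + e n \<in> S x) \<noteq> (s \<in> S x)} < a) sequentially"
          by eventually_elim (use \<delta>(2) \<eta>(2) r(1) in force)
      qed simp
    qed
  qed (use int_meas in \<open>auto simp: emeasure_space_1\<close>)
  then show ?thesis by (simp add: eq)
qed

end

section \<open>Ergodicity of diagonal matrices\<close>

lemma transvection_entry: "i \<noteq> j \<Longrightarrow> transvection i j s $ k $ l = of_bool (k = l) + (if k = i \<and> l = j then s else 0)"
  by (auto simp: transvection_def)

lemma transvection_add:
  "i \<noteq> j \<Longrightarrow> transvection i j (s + t) = transvection i j s ** transvection i j t"
  by (simp add: vec_eq_iff transvection_mult transvection_entry)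

lemma transvection_commutator:
  assumes "i \<noteq> j" "k \<noteq> i" "k \<noteq> j"
  shows "transvection i j s =
    transvection i k s ** (transvection k j 1 ** (transvection i k (- s) ** transvection k j (- 1)))"
  using assms by (simp add: vec_eq_iff transvection_mult transvection_entry)

lemma transvection_in_SL: "i \<noteq> j \<Longrightarrow> transvection i j s \<in> SL"
  by (simp add: SL_def det_transvection)

lemma borel_measurable_transvection: "transvection i j \<in> borel_measurable borel"
proof (rule borel_measurable_continuous_onI)
  have "continuous_on UNIV (\<lambda>s. if k = i \<and> l = j then s else of_bool (k = l) :: real)" for k l
    by (cases "k = i \<and> l = j") (auto intro!: continuous_intros simp del: if_split)
  then show "continuous_on UNIV (transvection i j)"
    unfolding transvection_def[abs_def] by (intro continuous_on_vec_lambda)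
qed

lemma det_scaleR: "det (c *\<^sub>R A) = c ^ CARD('n) * det (A :: real^'n^'n)"
proof -
  have "c *\<^sub>R A = (\<chi> i. c *s A $ i)"
    by (simp add: vec_eq_iff)
  then have "det (c *\<^sub>R A) = prod (\<lambda>_. c) (UNIV :: 'n set) * det (\<chi> i. A $ i)"
    by (simp only: det_rows_mul[of "\<lambda>_. c"])
  then show ?thesis by (simp)
qed

text \<open>Lebesgue measure on matrices of positive determinant, transported by this map, serves as a substitute
  for Haar measure on \<open>SL\<close>. Matrices of nonpositive determinant get a dummy value in \<open>SL\<close>, so that the
  map is total.\<close>

definition normalize_det :: "real^'n^'n \<Rightarrow> real^'n^'n" where
  "normalize_det g = (if det g > 0 then (1 / root CARD('n) (det g)) *\<^sub>R g else mat 1)"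

lemma normalize_det_in_SL: "normalize_det (g :: real^'n^'n) \<in> SL"
proof (cases "det g > 0")
  case True
  then have "(1 / root CARD('n) (det g)) ^ CARD('n) * det g = 1"
    using real_root_gt_zero[of "CARD('n)" "det g"] by (simp add: power_divide real_root_pow_pos2)
  then show ?thesis using True by (simp add: normalize_det_def SL_def det_scaleR)
qed (simp add: normalize_det_def SL_one)

lemma normalize_det_mult:
  assumes "h \<in> SL" "det g > 0"
  shows "normalize_det (g ** h) = normalize_det g ** h"
  using assms by (simp add: normalize_det_def SL_def det_mul scalar_matrix_assoc)

lemma continuous_on_det: "continuous_on UNIV (det :: real^'n^'n \<Rightarrow> real)"
  unfolding det_def by (intro continuous_intros)

lemma borel_measurable_normalize_det: "normalize_det \<in> borel_measurable borel"
proof -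
  have [measurable]: "(det :: real^'n^'n \<Rightarrow> real) \<in> borel_measurable borel"
    by (rule borel_measurable_continuous_onI[OF continuous_on_det])
  show ?thesis unfolding normalize_det_def by measurable
qed

context lattice_measure
begin

text \<open>Substituting \<open>a x\<close> for \<open>x\<close> changes neither the measure nor membership in \<open>E\<close>.\<close>

lemma displaced_conj:
  assumes E: "E \<in> sets m" and SL: "a \<in> SL" "g \<in> SL" "h \<in> SL"
    and inv: "\<And>x. x \<in> space m \<Longrightarrow> (act a x \<in> E) = (x \<in> E)"
    and gh: "g ** a = a ** h"
  shows "displaced E g = displaced E h"
proof -
  have "displaced E g = emeasure m {x \<in> space m. act a x \<in> {x \<in> space m. (act g x \<in> E) \<noteq> (x \<in> E)}}"
    unfolding displaced_def by (rule emeasure_act_preimage[symmetric]) (use displaced_sets[OF E] SL in auto)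
  also have "{x \<in> space m. act a x \<in> {x \<in> space m. (act g x \<in> E) \<noteq> (x \<in> E)}} = {x \<in> space m. (act h x \<in> E) \<noteq> (x \<in> E)}"
  proof (intro Collect_cong conj_cong refl)
    fix x assume x: "x \<in> space m"
    have 1: "act g (act a x) = act a (act h x)"
      unfolding act_act gh ..
    have 2: "act a x \<in> space m" "act h x \<in> space m"
      using x act_unimodular SL by (simp_all add: space_m)
    show "(act a x \<in> {x \<in> space m. (act g x \<in> E) \<noteq> (x \<in> E)}) = ((act h x \<in> E) \<noteq> (x \<in> E))"
      using 2(1) inv[OF x] inv[OF 2(2)] by (simp only: mem_Collect_eq simp_thms 1)
  qed
  finally show ?thesis by (simp add: displaced_def)
qed

lemma ae_invariantI:
  assumes "E \<in> sets m" "g \<in> SL" "displaced E g = 0"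
  shows "ae_invariant E g"
proof -
  have "{x \<in> space m. (act g x \<in> E) \<noteq> (x \<in> E)} \<in> null_sets m"
    using assms displaced_sets by (auto simp: displaced_def)
  then show ?thesis using assms(2) unfolding ae_invariant_def by (auto intro!: AE_I')
qed

lemma ae_invariant_mult:
  assumes "ae_invariant E g" "ae_invariant E h"
  shows "ae_invariant E (g ** h)"
proof -
  have SL: "g \<in> SL" "h \<in> SL" using assms by (auto simp: ae_invariant_def)
  have "AE x in distr m m (act h). (act g x \<in> E) = (x \<in> E)"
    using assms(1) unfolding distr_act[OF SL(2)] by (simp add: ae_invariant_def)
  from AE_distrD[OF act_measurable_single[OF SL(2)] this]
  have "AE x in m. (act (g ** h) x \<in> E) = (act h x \<in> E)" by (simp only: act_act)
  moreover have "AE x in m. (act h x \<in> E) = (x \<in> E)" using assms(2) by (simp add: ae_invariant_def)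
  ultimately have "AE x in m. (act (g ** h) x \<in> E) = (x \<in> E)" by eventually_elim metis
  then show ?thesis using SL by (simp add: ae_invariant_def SL_mult)
qed

text \<open>The Mautner phenomenon: conjugating by powers of \<open>a\<close> shrinks the transvection to the identity without
  changing the displacement, which is therefore the limit 0.\<close>

lemma ae_invariant_contracted_transvection:
  assumes E: "E \<in> sets m" and a: "a \<in> SL"
    and inv: "\<And>x. x \<in> space m \<Longrightarrow> (act a x \<in> E) = (x \<in> E)"
    and ij: "i \<noteq> j" and r: "\<bar>r\<bar> < 1"
    and contr: "\<And>s. transvection i j s ** a = a ** transvection i j (s * r)"
  shows "ae_invariant E (transvection i j s)"
proof -
  have "displaced E (transvection i j (s * r ^ n)) = displaced E (transvection i j s)" for n
  proof (induction n)
    case (Suc n)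
    have "transvection i j (s * r ^ n) ** a = a ** transvection i j (s * r ^ Suc n)"
      using contr[of "s * r ^ n"] by (simp add: mult_ac)
    from displaced_conj[OF E a transvection_in_SL[OF ij] transvection_in_SL[OF ij] inv this] Suc
    show ?case by simp
  qed simp
  moreover have "(\<lambda>n. displaced E (transvection i j (s * r ^ n))) \<longlonglongrightarrow> 0"
  proof (rule displaced_tendsto_0[OF E transvection_in_SL[OF ij] borel_measurable_transvection transvection_add[OF ij]])
    show "(\<lambda>n. s * r ^ n) \<longlonglongrightarrow> 0"
      using tendsto_mult_right_zero[OF LIMSEQ_power_zero[of r]] r by simp
  qed
  ultimately have "displaced E (transvection i j s) = 0"
    by (simp add: LIMSEQ_const_iff)
  then show ?thesis by (intro ae_invariantI E transvection_in_SL ij)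
qed

text \<open>A transvection \<open>transvection i j s\<close> is contracted by the diagonal matrix or by its inverse unless the
  entries \<open>d i\<close> and \<open>d j\<close> agree. In that case it is a commutator of two transvections through a coordinate
  \<open>k\<close> with a different entry.\<close>

lemma ae_invariant_under_SL:
  assumes E: "E \<in> sets m" and a: "diag_matrix d \<in> SL" and d: "\<And>i. d i > 0" and nonconst: "d i0 \<noteq> d j0"
    and inv: "\<And>x. x \<in> space m \<Longrightarrow> (act (diag_matrix d) x \<in> E) = (x \<in> E)"
    and g: "g \<in> SL"
  shows "ae_invariant E g"
proof -
  have unequal: "ae_invariant E (transvection i j s)" if ne: "d i \<noteq> d j" for i j s
  proof (cases "d j < d i")
    case True
    show ?thesis
    proof (rule ae_invariant_contracted_transvection[OF E a inv])
      show "i \<noteq> j" using ne by auto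
      show "\<bar>d j / d i\<bar> < 1" using True d[of i] d[of j] by simp
      show "transvection i j s ** diag_matrix d = diag_matrix d ** transvection i j (s * (d j / d i))" for s
        using diag_matrix_transvection[of i j d "s * (d j / d i)", OF \<open>i \<noteq> j\<close>] d[of i] d[of j] by auto
    qed
  next
    case False
    define d' where "d' k = 1 / d k" for k
    have d': "diag_matrix d ** diag_matrix d' = mat 1" "diag_matrix d' ** diag_matrix d = mat 1"
      unfolding diag_matrix_mult_diag_matrix using d by (simp_all add: d'_def less_imp_neq[symmetric]) (simp_all add: diag_matrix_def mat_def)
    have "det (diag_matrix d) * det (diag_matrix d') = 1" by (metis d'(1) det_mul det_I)
    then have a': "diag_matrix d' \<in> SL" using a by (simp add: SL_def)
    show ?thesis
    proof (rule ae_invariant_contracted_transvection[OF E a'])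
      fix x assume x: "x \<in> space m"
      have "act (diag_matrix d') x \<in> space m" using x act_unimodular[OF a'] by (simp add: space_m)
      from inv[OF this] show "(act (diag_matrix d') x \<in> E) = (x \<in> E)"
        unfolding act_act d' act_one by simp
    next
      show "i \<noteq> j" using ne by auto
      show "\<bar>d i / d j\<bar> < 1" using False ne d[of i] d[of j] by simp
      show "transvection i j s ** diag_matrix d' = diag_matrix d' ** transvection i j (s * (d i / d j))" for s
        using diag_matrix_transvection[of i j d' "s * (d i / d j)", OF \<open>i \<noteq> j\<close>] d[of i] d[of j] by (auto simp: d'_def)
    qed
  qed
  have gen: "ae_invariant E (transvection i j s)" if ij: "i \<noteq> j" for i j s
  proof (cases "d i = d j")
    case True
    obtain k where k: "d k \<noteq> d i" using nonconst by metis
    have "k \<noteq> i" "k \<noteq> j" using k True by auto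
    then show ?thesis
      unfolding transvection_commutator[OF ij \<open>k \<noteq> i\<close> \<open>k \<noteq> j\<close>, of s]
      using k True by (intro ae_invariant_mult unequal) auto
  qed (rule unequal)
  have "g \<in> transvection_group" using g by (simp add: transvection_group_eq_SL)
  then show ?thesis
  proof induction
    case one
    show ?case unfolding ae_invariant_def act_one by (simp add: SL_one)
  qed (auto intro: gen ae_invariant_mult)
qed

text \<open>If neither \<open>E\<close> nor its complement were null, Fubini would give a lattice \<open>x\<close> in \<open>E\<close> and a lattice
  \<open>y = h x\<close> outside \<open>E\<close> such that for almost all \<open>g\<close> the normalized \<open>g\<close> moves \<open>x\<close> into \<open>E\<close> and \<open>y\<close> out of
  \<open>E\<close>. As right multiplication by \<open>h\<close> preserves null sets of matrices, the image of \<open>y\<close> is the image of \<open>x\<close>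
  under the normalized \<open>g h\<close>, which is in \<open>E\<close> for almost all \<open>g\<close> as well.\<close>

theorem diagonal_ergodic:
  assumes E: "E \<in> sets m" and a: "diag_matrix d \<in> SL" "\<And>i. d i > 0" "d i0 \<noteq> d j0"
    and inv: "\<And>x. x \<in> space m \<Longrightarrow> (act (diag_matrix d) x \<in> E) = (x \<in> E)"
    and pos: "emeasure m E \<noteq> 0"
  shows "AE x in m. x \<in> E"
proof (rule ccontr)
  assume not_AE: "\<not> (AE x in m. x \<in> E)"
  interpret L: pair_sigma_finite "lborel :: (real^'n^'n) measure" m ..
  have [measurable]: "(\<lambda>p. act (normalize_det (fst p)) (snd p)) \<in> lborel \<Otimes>\<^sub>M m \<rightarrow>\<^sub>M m"
    by (intro act_measurable_compose normalize_det_in_SL) (simp add: borel_measurable_normalize_det)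
  note [measurable] = E
  have "AE g in lborel. AE x in m. (act (normalize_det g) x \<in> E) = (x \<in> E)"
  proof (rule always_eventually, rule allI)
    fix g :: "real^'n^'n"
    have "ae_invariant E (normalize_det g)"
      by (rule ae_invariant_under_SL[OF E a inv normalize_det_in_SL])
    then show "AE x in m. (act (normalize_det g) x \<in> E) = (x \<in> E)" by (simp add: ae_invariant_def)
  qed
  then have ae: "AE x in m. AE g in lborel. (act (normalize_det g) x \<in> E) = (x \<in> E)"
    by (subst (asm) L.AE_commute) measurable
  have "\<exists>x\<in>space m. x \<in> E \<and> (AE g in lborel. (act (normalize_det g) x \<in> E) = (x \<in> E))"
  proof (rule ccontr)
    assume "\<not> ?thesis"
    then have "AE x in m. x \<notin> E" using ae by (auto elim!: AE_mp)
    moreover have "{x \<in> space m. \<not> x \<notin> E} = E" using sets.sets_into_space[OF E] by blast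
    ultimately show False using pos by (simp add: AE_iff_measurable[OF E])
  qed
  then obtain x where x: "x \<in> space m" "AE g in lborel. act (normalize_det g) x \<in> E" by auto
  have "\<exists>y\<in>space m. y \<notin> E \<and> (AE g in lborel. (act (normalize_det g) y \<in> E) = (y \<in> E))"
  proof (rule ccontr)
    assume "\<not> ?thesis"
    then have "AE x in m. x \<in> E" using ae by (auto elim!: AE_mp)
    then show False using not_AE by simp
  qed
  then obtain y where y: "y \<in> space m" "AE g in lborel. act (normalize_det g) y \<notin> E" by auto
  obtain k l where kl: "k \<in> SL" "l \<in> SL" "x = lattice_of k" "y = lattice_of l"
    using x(1) y(1) unfolding space_m unimodular_lattices_def by blast
  obtain k' where k': "k' \<in> SL" "k' ** k = mat 1" using SL_inverse[OF kl(1)] by blast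
  define h where "h = l ** k'"
  have h: "h \<in> SL" unfolding h_def using kl k' SL_mult by blast
  have yh: "y = act h x"
    unfolding kl h_def lattice_of_mult[symmetric] by (simp add: matrix_mul_assoc[symmetric] k')
  obtain h' where h': "h' \<in> SL" "h ** h' = mat 1" using SL_inverse[OF h] by blast
  define X where "X = {g. act (normalize_det g) x \<notin> E}"
  define Y where "Y = {g. act (normalize_det g) y \<in> E}"
  have negl: "negligible {g. \<not> P g}" if P: "AE g in lborel. P g" for P :: "real^'n^'n \<Rightarrow> bool"
  proof -
    obtain N where N: "N \<in> null_sets lborel" "{g \<in> space lborel. \<not> P g} \<subseteq> N"
      using P unfolding eventually_ae_filter by blast
    have "negligible N" unfolding negligible_iff_null_sets by (rule null_sets_completionI[OF N(1)])
    then show ?thesis by (rule negligible_subset) (use N(2) in simp)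
  qed
  have "negligible X" unfolding X_def by (rule negl[OF x(2)])
  have "negligible Y" using negl[OF y(2)] unfolding Y_def not_not .
  have lin: "linear (\<lambda>g::real^'n^'n. g ** h')"
    by (intro linearI) (simp_all add: vec_eq_iff matrix_matrix_mult_def algebra_simps sum.distrib sum_distrib_left)
  have "negligible ((\<lambda>g. g ** h') ` X)"
    using \<open>negligible X\<close> linear_imp_differentiable_on[OF lin]
    by (intro negligible_differentiable_image_negligible) simp_all
  then have "negligible ((\<lambda>g. g ** h') ` X \<union> Y)" using \<open>negligible Y\<close> by simp
  moreover have "{g. det g > 0} \<subseteq> (\<lambda>g. g ** h') ` X \<union> Y"
  proof
    fix g :: "real^'n^'n" assume "g \<in> {g. det g > 0}"
    then have dg: "det g > 0" by simp
    have "act (normalize_det g) y = act (normalize_det (g ** h)) x"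
      unfolding yh act_act normalize_det_mult[OF h dg] ..
    then have "g \<in> Y \<or> g ** h \<in> X" unfolding X_def Y_def mem_Collect_eq by metis
    moreover have "g = (g ** h) ** h'" by (simp add: matrix_mul_assoc[symmetric] h')
    then have "g \<in> (\<lambda>g. g ** h') ` X" if "g ** h \<in> X" using that by (rule image_eqI)
    ultimately show "g \<in> (\<lambda>g. g ** h') ` X \<union> Y" by (elim disjE) simp_all
  qed
  ultimately have "negligible {g :: real^'n^'n. det g > 0}" by (rule negligible_subset)
  moreover have "open {g :: real^'n^'n. det g > 0}"
    by (intro open_Collect_less continuous_on_det continuous_on_const)
  moreover have "mat 1 \<in> {g :: real^'n^'n. det g > 0}" by simp
  ultimately show False using open_not_negligible[of "{g :: real^'n^'n. det g > 0}"] by fastforce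
qed

end

section \<open>Frequent returns to lattices with a bounded basis\<close>

definition bounded_basis_lattices :: "real \<Rightarrow> (real^'n) set set" where
  "bounded_basis_lattices D = lattice_of ` ({g. \<forall>i j. \<bar>g $ i $ j\<bar> < D} \<inter> SL)"

lemma open_bounded_entries: "open {g :: real^'n^'n. \<forall>i j. \<bar>g $ i $ j\<bar> < D}"
proof -
  have "{g :: real^'n^'n. \<forall>i j. \<bar>g $ i $ j\<bar> < D} = (\<Inter>i. \<Inter>j. {g. \<bar>g $ i $ j\<bar> < D})" by auto
  also have "open \<dots>"
    by (intro open_INT finite ballI open_Collect_less continuous_intros)
  finally show ?thesis .
qed

text \<open>Round the coordinates with respect to the bounded basis.\<close>

lemma bounded_basis_lattice_covering:
  fixes x :: "(real^'n) set"
  assumes "x \<in> bounded_basis_lattices D"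
  shows "\<exists>z\<in>x. \<forall>j. \<bar>z $ j - u $ j\<bar> \<le> real CARD('n) * D"
proof -
  obtain g where g: "g \<in> SL" "x = lattice_of g" "\<And>i j. \<bar>g $ i $ j\<bar> < D"
    using assms by (auto simp: bounded_basis_lattices_def)
  obtain h where h: "g ** h = mat 1" using SL_inverse[OF g(1)] by blast
  define v where "v = h *v u"
  have gv: "g *v v = u" by (simp add: v_def matrix_vector_mul_assoc h)
  define k where "k = ((\<chi> i. of_int \<lfloor>v $ i\<rfloor>) :: real^'n)"
  have "g *v k \<in> x" unfolding g(2) lattice_of_def k_def by (intro imageI) (simp add: int_lattice_def)
  moreover have "\<bar>(g *v k) $ j - u $ j\<bar> \<le> real CARD('n) * D" for j
  proof -
    have "(g *v k) $ j - u $ j = (\<Sum>i\<in>UNIV. g $ j $ i * (k $ i - v $ i))"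
      unfolding gv[symmetric] by (simp add: matrix_vector_mult_def algebra_simps sum_subtractf)
    also have "\<bar>\<dots>\<bar> \<le> (\<Sum>i\<in>UNIV. \<bar>g $ j $ i * (k $ i - v $ i)\<bar>)" by (rule sum_abs)
    also have "\<dots> \<le> (\<Sum>i\<in>(UNIV :: 'n set). D * 1)"
    proof (rule sum_mono)
      fix i
      have "\<bar>k $ i - v $ i\<bar> \<le> 1" unfolding k_def by (simp add: abs_le_iff) linarith
      then show "\<bar>g $ j $ i * (k $ i - v $ i)\<bar> \<le> D * 1"
        unfolding abs_mult using g(3)[of j i] by (intro mult_mono) auto
    qed
    finally show ?thesis by simp
  qed
  ultimately show ?thesis by blast
qed

definition visits :: "('a \<Rightarrow> 'a) \<Rightarrow> 'a set \<Rightarrow> nat \<Rightarrow> 'a \<Rightarrow> nat" where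
  "visits f K N x = card {n. n < N \<and> (f ^^ n) x \<in> K}"

lemma visits_Suc: "visits f K (Suc N) x = visits f K N x + of_bool ((f ^^ N) x \<in> K)"
proof -
  have "{n. n < Suc N \<and> (f ^^ n) x \<in> K} = {n. n < N \<and> (f ^^ n) x \<in> K} \<union> (if (f ^^ N) x \<in> K then {N} else {})"
    by (auto simp: less_Suc_eq)
  then show ?thesis by (simp add: visits_def)
qed

lemma visits_0: "visits f K 0 x = 0"
  by (simp add: visits_def)

lemma visits_le: "visits f K N x \<le> N"
  by (induction N) (auto simp: visits_0 visits_Suc of_bool_def le_SucI)

lemma visits_shift: "visits f K N (f x) + of_bool (x \<in> K) = visits f K N x + of_bool ((f ^^ N) x \<in> K)"
  by (induction N) (simp_all add: visits_0 visits_Suc funpow_swap1)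

text \<open>The upper density of the visits is at least 1/2, up to an additive constant \<open>C\<close>. The constant makes
  the property exactly invariant under the dynamics, because a shift changes the number of visits by at
  most one.\<close>

definition often_in :: "('a \<Rightarrow> 'a) \<Rightarrow> 'a set \<Rightarrow> 'a \<Rightarrow> bool" where
  "often_in f K x \<longleftrightarrow> (\<exists>C. \<exists>\<^sub>\<infinity>N. N \<le> 2 * visits f K N x + C)"

lemma often_in_shift: "often_in f K (f x) = often_in f K x"
proof -
  have le: "visits f K N (f x) \<le> visits f K N x + 1" "visits f K N x \<le> visits f K N (f x) + 1" for N
    using visits_shift[of f K N x] by (auto simp: of_bool_def split: if_splits)
  have "N \<le> 2 * visits f K N x + (C + 2)" if "N \<le> 2 * visits f K N (f x) + C" for N C
    using that le(1)[of N] by linarith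
  moreover have "N \<le> 2 * visits f K N (f x) + (C + 2)" if "N \<le> 2 * visits f K N x + C" for N C
    using that le(2)[of N] by linarith
  ultimately show ?thesis unfolding often_in_def by (meson INFM_mono)
qed

context lattice_measure
begin

lemma bounded_basis_lattices_sets: "bounded_basis_lattices D \<in> sets m"
  unfolding bounded_basis_lattices_def by (intro openin_sets lattice_of_open_map open_bounded_entries)

lemma exists_large_bounded_basis_lattices:
  assumes "e < 1"
  shows "\<exists>D. prob (bounded_basis_lattices D) > e"
proof -
  have "(\<lambda>n. prob (bounded_basis_lattices (real n))) \<longlonglongrightarrow> prob (\<Union>n. bounded_basis_lattices (real n))"
  proof (rule finite_Lim_measure_incseq)
    show "incseq (\<lambda>n. bounded_basis_lattices (real n) :: (real^'n) set set)"
    proof (rule incseq_SucI, unfold bounded_basis_lattices_def, rule image_mono, rule Int_mono[OF Collect_mono order_refl], intro impI allI)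
      fix n and g :: "real^'n^'n" and i j assume "\<forall>i j. \<bar>g $ i $ j\<bar> < real n"
      then have "\<bar>g $ i $ j\<bar> < real n" by blast
      then show "\<bar>g $ i $ j\<bar> < real (Suc n)" by simp
    qed
  qed (auto simp: bounded_basis_lattices_sets)
  moreover have "(\<Union>n. bounded_basis_lattices (real n)) = (space m :: (real^'n) set set)"
  proof (intro equalityI subsetI)
    fix x assume "x \<in> space m"
    then obtain g where g: "g \<in> SL" "x = lattice_of g" by (auto simp: space_m unimodular_lattices_def)
    obtain n where n: "real n > Max (range (\<lambda>(i, j). \<bar>g $ i $ j\<bar>))"
      using reals_Archimedean2 by blast
    have "\<bar>g $ i $ j\<bar> < real n" for i j
    proof -
      have "\<bar>g $ i $ j\<bar> \<le> Max (range (\<lambda>(i, j). \<bar>g $ i $ j\<bar>))" by (rule Max_ge) auto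
      then show ?thesis using n by simp
    qed
    then have "x \<in> bounded_basis_lattices (real n)" using g by (auto simp: bounded_basis_lattices_def)
    then show "x \<in> (\<Union>n. bounded_basis_lattices (real n))" by blast
  next
    fix x assume "x \<in> (\<Union>n. bounded_basis_lattices (real n) :: (real^'n) set set)"
    then show "x \<in> space m" using bounded_basis_lattices_sets sets.sets_into_space by blast
  qed
  ultimately have "(\<lambda>n. prob (bounded_basis_lattices (real n))) \<longlonglongrightarrow> 1" by (simp add: prob_space)
  from eventually_happens'[OF sequentially_bot order_tendstoD(1)[OF this assms]]
  show ?thesis by blast
qed

lemma funpow_act_measurable: "a \<in> SL \<Longrightarrow> (act a ^^ n) \<in> m \<rightarrow>\<^sub>M m"
  by (induction n) (auto intro: measurable_comp act_measurable_single)

lemma prob_funpow_act: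
  assumes "a \<in> SL" "K \<in> sets m"
  shows "prob {x \<in> space m. (act a ^^ n) x \<in> K} = prob K"
proof (induction n)
  case 0
  have "{x \<in> space m. x \<in> K} = K" using sets.sets_into_space[OF assms(2)] by blast
  then show ?case by simp
next
  case (Suc n)
  have S: "{x \<in> space m. (act a ^^ n) x \<in> K} \<in> sets m"
    using measurable_sets[OF funpow_act_measurable[OF assms(1)] assms(2), of n]
    by (simp add: vimage_def Int_def conj_commute)
  have "{x \<in> space m. (act a ^^ Suc n) x \<in> K} = {x \<in> space m. act a x \<in> {x \<in> space m. (act a ^^ n) x \<in> K}}"
    using act_unimodular[OF assms(1)] unfolding space_m funpow_Suc_right comp_def by blast
  then have "prob {x \<in> space m. (act a ^^ Suc n) x \<in> K} = prob {x \<in> space m. (act a ^^ n) x \<in> K}"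
    using emeasure_act_preimage[OF assms(1) S] by (simp only: measure_def)
  then show ?case using Suc by simp
qed

lemma visits_measurable [measurable]:
  assumes "a \<in> SL" "K \<in> sets m"
  shows "visits (act a) K N \<in> measurable m (count_space UNIV)"
proof (induction N)
  case (Suc N)
  note [measurable] = Suc funpow_act_measurable[OF assms(1)] assms(2)
  show ?case unfolding visits_Suc[abs_def] by measurable
qed (simp add: visits_0[abs_def])

lemma expectation_visits:
  assumes "a \<in> SL" "K \<in> sets m"
  shows "expectation (\<lambda>x. real (visits (act a) K N x)) = N * prob K"
proof (induction N)
  case (Suc N)
  have S: "{x \<in> space m. (act a ^^ N) x \<in> K} \<in> sets m"
    using measurable_sets[OF funpow_act_measurable[OF assms(1)] assms(2), of N]
    by (simp add: vimage_def Int_def conj_commute)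
  have V: "integrable m (\<lambda>x. real (visits (act a) K N x))"
  proof (rule integrable_const_bound[where B = "real N"])
    show "AE x in m. norm (real (visits (act a) K N x)) \<le> real N"
      using visits_le by (intro AE_I2) simp
    note [measurable] = visits_measurable[OF assms]
    show "(\<lambda>x. real (visits (act a) K N x)) \<in> borel_measurable m" by measurable
  qed
  have "expectation (\<lambda>x. real (visits (act a) K (Suc N) x)) =
    expectation (\<lambda>x. real (visits (act a) K N x) + indicator {x \<in> space m. (act a ^^ N) x \<in> K} x)"
    by (intro Bochner_Integration.integral_cong refl) (simp add: visits_Suc indicator_def)
  also have "\<dots> = expectation (\<lambda>x. real (visits (act a) K N x)) + prob {x \<in> space m. (act a ^^ N) x \<in> K}"
    using S by (subst Bochner_Integration.integral_add[OF V]) (auto simp: emeasure_eq_measure)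
  finally show ?case using Suc by (simp add: prob_funpow_act[OF assms] algebra_simps)
qed (simp add: visits_0)

text \<open>The expected number of visits before time \<open>N\<close> is at least \<open>3N/4\<close>, so with probability at least 1/4 the
  number of visits is at least \<open>N/2\<close>. By continuity from above this lower bound passes to the event that
  this happens for infinitely many \<open>N\<close>.\<close>

lemma often_in_positive_probability:
  assumes a: "a \<in> SL" and K: "K \<in> sets m" and pK: "prob K \<ge> 3/4"
  shows "{x \<in> space m. often_in (act a) K x} \<in> sets m"
    "emeasure m {x \<in> space m. often_in (act a) K x} \<noteq> 0"
proof -
  note [measurable] = visits_measurable[OF a K]
  show S: "{x \<in> space m. often_in (act a) K x} \<in> sets m"
    unfolding often_in_def INFM_nat by measurable
  define B where "B N = {x \<in> space m. N \<le> 2 * visits (act a) K N x}" for N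
  have B[measurable]: "B N \<in> sets m" for N unfolding B_def by measurable
  have pB: "prob (B N) \<ge> 1/4" if "N > 0" for N
  proof -
    have "real N * (3/4) \<le> real N * prob K" using pK by (intro mult_left_mono) auto
    also have "\<dots> = expectation (\<lambda>x. real (visits (act a) K N x))" by (simp add: expectation_visits[OF a K])
    also have "\<dots> \<le> expectation (\<lambda>x. real N / 2 + real N * indicator (B N) x)"
    proof (rule integral_mono)
      show "integrable m (\<lambda>x. real (visits (act a) K N x))"
        by (rule integrable_const_bound[where B = "real N"]) (auto intro!: AE_I2 simp: visits_le)
      show "integrable m (\<lambda>x. real N / 2 + real N * indicator (B N) x)"
        using B by (auto simp: emeasure_eq_measure)
      fix x assume "x \<in> space m"
      then show "real (visits (act a) K N x) \<le> real N / 2 + real N * indicator (B N) x"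
        using visits_le[of "act a" K N x] by (auto simp: B_def indicator_def)
    qed
    also have "\<dots> = real N / 2 + real N * prob (B N)"
      using B by (subst Bochner_Integration.integral_add) (auto simp: emeasure_eq_measure prob_space)
    finally have "real N * (1/4) \<le> real N * prob (B N)" by simp
    then show ?thesis using that by simp
  qed
  have "(\<lambda>M. prob (\<Union>N\<in>{M<..}. B N)) \<longlonglongrightarrow> prob (\<Inter>M. \<Union>N\<in>{M<..}. B N)"
  proof (rule finite_Lim_measure_decseq)
    show "decseq (\<lambda>M. \<Union>N\<in>{M<..}. B N)" by (intro decseq_SucI UN_mono) auto
  qed auto
  moreover have "prob (\<Union>N\<in>{M<..}. B N) \<ge> 1/4" for M
  proof -
    have "1/4 \<le> prob (B (Suc M))" by (rule pB) simp
    also have "\<dots> \<le> prob (\<Union>N\<in>{M<..}. B N)" by (intro finite_measure_mono) auto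
    finally show ?thesis .
  qed
  ultimately have "prob (\<Inter>M. \<Union>N\<in>{M<..}. B N) \<ge> 1/4"
    by (intro LIMSEQ_le_const) auto
  moreover have "prob (\<Inter>M. \<Union>N\<in>{M<..}. B N) \<le> prob {x \<in> space m. often_in (act a) K x}"
  proof (intro finite_measure_mono S subsetI)
    fix x assume x: "x \<in> (\<Inter>M. \<Union>N\<in>{M<..}. B N)"
    then have "\<exists>\<^sub>\<infinity>N. N \<le> 2 * visits (act a) K N x + 0"
      unfolding INFM_nat by (auto simp: B_def) 
    moreover have "x \<in> space m" using x by (auto simp: B_def)
    ultimately show "x \<in> {x \<in> space m. often_in (act a) K x}" unfolding often_in_def by blast
  qed
  ultimately show "emeasure m {x \<in> space m. often_in (act a) K x} \<noteq> 0"
    by (simp add: emeasure_eq_measure)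
qed

theorem AE_often_in:
  assumes a: "diag_matrix d \<in> SL" "\<And>i. d i > 0" "d i0 \<noteq> d j0"
    and K: "K \<in> sets m" "prob K \<ge> 3/4"
  shows "AE x in m. often_in (act (diag_matrix d)) K x"
proof -
  have "AE x in m. x \<in> {x \<in> space m. often_in (act (diag_matrix d)) K x}"
  proof (rule diagonal_ergodic[OF _ a])
    fix x assume x: "x \<in> space m"
    have "act (diag_matrix d) x \<in> space m" using x act_unimodular[OF a(1)] by (simp add: space_m)
    then show "(act (diag_matrix d) x \<in> {x \<in> space m. often_in (act (diag_matrix d)) K x}) =
      (x \<in> {x \<in> space m. often_in (act (diag_matrix d)) K x})"
      using x often_in_shift[of "act (diag_matrix d)" K x] by (simp only: mem_Collect_eq simp_thms)
  qed (use often_in_positive_probability[OF a(1) K] in auto)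
  then show ?thesis by (auto elim: AE_mp)
qed

end

section \<open>Dyadic boxes adapted to the flow\<close>

text \<open>The code of a point names the half-open dyadic box that contains it, with side \<open>2 ^ - p j\<close> in
  coordinate \<open>j\<close>. Boxes are counted through their codes.\<close>

definition cube_code :: "('n \<Rightarrow> nat) \<Rightarrow> real^'n \<Rightarrow> 'n \<Rightarrow> int" where
  "cube_code p w = (\<lambda>j. \<lfloor>2 ^ p j * w $ j\<rfloor>)"

definition code_children :: "('n \<Rightarrow> nat) \<Rightarrow> ('n \<Rightarrow> int) \<Rightarrow> ('n \<Rightarrow> int) set" where
  "code_children r b = {k. \<forall>j. k j div 2 ^ r j = b j}"

lemma floor_power2_coarsen: "\<lfloor>2 ^ (p + r) * (y :: real)\<rfloor> div 2 ^ r = \<lfloor>2 ^ p * y\<rfloor>"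
proof -
  have "\<lfloor>2 ^ (p + r) * y / real_of_int (2 ^ r)\<rfloor> = \<lfloor>2 ^ (p + r) * y\<rfloor> div 2 ^ r"
    by (rule floor_divide_real_eq_div) simp
  then show ?thesis by (simp add: power_add)
qed

lemma cube_code_in_children:
  assumes "\<And>j. p j \<le> p' j"
  shows "cube_code p' w \<in> code_children (\<lambda>j. p' j - p j) (cube_code p w)"
  unfolding code_children_def cube_code_def
proof (intro CollectI allI)
  fix j
  show "\<lfloor>2 ^ p' j * w $ j\<rfloor> div 2 ^ (p' j - p j) = \<lfloor>2 ^ p j * w $ j\<rfloor>"
    using floor_power2_coarsen[of "p j" "p' j - p j" "w $ j"] assms[of j] by simp
qed

lemma card_code_children:
  fixes r :: "'n::finite \<Rightarrow> nat"
  shows "finite (code_children r b)" "card (code_children r b) = 2 ^ (\<Sum>j\<in>UNIV. r j)"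
proof -
  have 1: "{k :: int. k div 2 ^ s = b} = {b * 2 ^ s..<(b + 1) * 2 ^ s}" for s b
  proof (intro set_eqI iffI)
    fix k :: int assume "k \<in> {b * 2 ^ s..<(b + 1) * 2 ^ s}"
    then have "0 \<le> k - b * 2 ^ s" "k - b * 2 ^ s < 2 ^ s" by (auto simp: algebra_simps)
    then have "(k - b * 2 ^ s + b * 2 ^ s) div 2 ^ s = b" by (subst div_mult_self1) (auto)
    then show "k \<in> {k. k div 2 ^ s = b}" by simp
  next
    fix k :: int assume "k \<in> {k. k div 2 ^ s = b}"
    then have "k = b * 2 ^ s + k mod 2 ^ s" using div_mult_mod_eq[of k "2 ^ s"] by simp
    moreover have "0 \<le> k mod 2 ^ s" "k mod 2 ^ s < 2 ^ s" by simp_all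
    ultimately show "k \<in> {b * 2 ^ s..<(b + 1) * 2 ^ s}" unfolding atLeastLessThan_iff distrib_right mult_1 by linarith
  qed
  have eq: "code_children r b = (\<Pi>\<^sub>E j\<in>UNIV. {b j * 2 ^ r j..<(b j + 1) * 2 ^ r j})"
    unfolding 1[symmetric] by (simp add: code_children_def PiE_UNIV_domain Pi_def)
  show "finite (code_children r b)" unfolding eq by (intro finite_PiE) auto
  have "card (code_children r b) = (\<Prod>j\<in>UNIV. 2 ^ r j)"
    unfolding eq by (subst card_PiE) (auto intro!: prod.cong simp: algebra_simps nat_power_eq)
  then show "card (code_children r b) = 2 ^ (\<Sum>j\<in>UNIV. r j)" by (simp add: power_sum)
qed

lemma card_cube_codes_refine:
  fixes p p' :: "'n::finite \<Rightarrow> nat"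
  assumes le: "\<And>j. p j \<le> p' j" and fin: "finite (cube_code p ` A)"
  shows "finite (cube_code p' ` A)"
    and "card (cube_code p' ` A) \<le> card (cube_code p ` A) * 2 ^ (\<Sum>j\<in>UNIV. p' j - p j)"
proof -
  have sub: "cube_code p' ` A \<subseteq> (\<Union>b\<in>cube_code p ` A. code_children (\<lambda>j. p' j - p j) b)"
  proof
    fix a assume "a \<in> cube_code p' ` A"
    then obtain w where "w \<in> A" "a = cube_code p' w" by blast
    then show "a \<in> (\<Union>b\<in>cube_code p ` A. code_children (\<lambda>j. p' j - p j) b)"
      using cube_code_in_children[OF le] by (intro UN_I[OF imageI]) simp_all
  qed
  have fin': "finite (\<Union>b\<in>cube_code p ` A. code_children (\<lambda>j. p' j - p j) b)"
    by (intro finite_UN_I fin card_code_children(1))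
  show "finite (cube_code p' ` A)" using sub fin' by (rule finite_subset)
  have "card (cube_code p' ` A) \<le> (\<Sum>b\<in>cube_code p ` A. card (code_children (\<lambda>j. p' j - p j) b))"
    by (rule order_trans[OF card_mono[OF fin' sub] card_UN_le[OF fin]])
  then show "card (cube_code p' ` A) \<le> card (cube_code p ` A) * 2 ^ (\<Sum>j\<in>UNIV. p' j - p j)"
    by (simp add: card_code_children)
qed

text \<open>If every box has at least one subbox that the set misses, each box contributes one subbox fewer.\<close>

lemma card_cube_codes_refine_gap:
  fixes p p' :: "'n::finite \<Rightarrow> nat"
  assumes le: "\<And>j. p j \<le> p' j" and fin: "finite (cube_code p ` A)"
    and gap: "\<And>b. \<exists>k\<in>code_children (\<lambda>j. p' j - p j) b. k \<notin> cube_code p' ` A"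
  shows "card (cube_code p' ` A) \<le> card (cube_code p ` A) * (2 ^ (\<Sum>j\<in>UNIV. p' j - p j) - 1)"
proof -
  have "\<forall>b. \<exists>k. k \<in> code_children (\<lambda>j. p' j - p j) b \<and> k \<notin> cube_code p' ` A"
    using gap by blast
  then obtain k where "\<forall>b. k b \<in> code_children (\<lambda>j. p' j - p j) b \<and> k b \<notin> cube_code p' ` A"
    by (rule choice[THEN exE])
  then have k: "\<And>b. k b \<in> code_children (\<lambda>j. p' j - p j) b" "\<And>b. k b \<notin> cube_code p' ` A"
    by simp_all
  have sub: "cube_code p' ` A \<subseteq> (\<Union>b\<in>cube_code p ` A. code_children (\<lambda>j. p' j - p j) b - {k b})"
  proof
    fix a assume a: "a \<in> cube_code p' ` A"
    then obtain w where w: "w \<in> A" "a = cube_code p' w" by blast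
    have "a \<noteq> k (cube_code p w)" using a k(2)[of "cube_code p w"] by metis
    then have "a \<in> code_children (\<lambda>j. p' j - p j) (cube_code p w) - {k (cube_code p w)}"
      using cube_code_in_children[OF le] w(2) by simp
    with w(1) show "a \<in> (\<Union>b\<in>cube_code p ` A. code_children (\<lambda>j. p' j - p j) b - {k b})"
      by (intro UN_I[OF imageI])
  qed
  have fin': "finite (\<Union>b\<in>cube_code p ` A. code_children (\<lambda>j. p' j - p j) b - {k b})"
    by (intro finite_UN_I fin finite_Diff card_code_children(1))
  have "card (cube_code p' ` A) \<le> (\<Sum>b\<in>cube_code p ` A. card (code_children (\<lambda>j. p' j - p j) b - {k b}))"
    by (rule order_trans[OF card_mono[OF fin' sub] card_UN_le[OF fin]])
  moreover have "card (code_children (\<lambda>j. p' j - p j) b - {k b}) = 2 ^ (\<Sum>j\<in>UNIV. p' j - p j) - 1" for b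
    by (subst card_Diff_singleton[OF k(1)]) (simp only: card_code_children)
  ultimately show ?thesis by simp
qed

text \<open>A good index \<open>n\<close> gives a gain from \<open>n - 1\<close> to \<open>n + 1\<close>, and the steps of consecutive good indices overlap.
  For the product \<open>X (n + 1) * X n\<close> each good index gives a clean factor \<open>\<theta>\<close>.\<close>

lemma two_step_decay:
  fixes X :: "nat \<Rightarrow> real"
  assumes nonneg: "\<And>n. X n \<ge> 0" and mono: "\<And>n. X (Suc n) \<le> X n" and \<theta>: "0 \<le> \<theta>"
    and good: "\<And>n. G (Suc n) \<Longrightarrow> X (Suc (Suc n)) \<le> \<theta> * X n"
  shows "(X N)\<^sup>2 \<le> \<theta> ^ card {n. n < N \<and> n > 0 \<and> G n} * (X 0)\<^sup>2"
proof -
  have prod: "X (Suc N) * X N \<le> \<theta> ^ card {n. n < Suc N \<and> n > 0 \<and> G n} * (X 0)\<^sup>2" for N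
  proof (induction N)
    case 0
    have "{n. n < Suc 0 \<and> n > 0 \<and> G n} = {}" by auto
    then have "\<theta> ^ card {n. n < Suc 0 \<and> n > 0 \<and> G n} = 1" by (simp only: card.empty power_0)
    then show ?case using mult_right_mono[OF mono nonneg, of 0 0] by (simp only: power2_eq_square mult_1)
  next
    case (Suc N)
    have S: "{n. n < Suc (Suc N) \<and> n > 0 \<and> G n} = {n. n < Suc N \<and> n > 0 \<and> G n} \<union> (if G (Suc N) then {Suc N} else {})"
      by (auto simp: less_Suc_eq)
    show ?case
    proof (cases "G (Suc N)")
      case True
      have "card {n. n < Suc (Suc N) \<and> n > 0 \<and> G n} = Suc (card {n. n < Suc N \<and> n > 0 \<and> G n})"
        unfolding S using True by simp
      moreover have "X (Suc (Suc N)) * X (Suc N) \<le> (\<theta> * X N) * X (Suc N)"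
        by (intro mult_right_mono good True nonneg)
      moreover have "\<theta> * (X (Suc N) * X N) \<le> \<theta> * (\<theta> ^ card {n. n < Suc N \<and> n > 0 \<and> G n} * (X 0)\<^sup>2)"
        by (intro mult_left_mono Suc \<theta>)
      ultimately show ?thesis by (simp add: mult_ac)
    next
      case False
      have "X (Suc (Suc N)) * X (Suc N) \<le> X N * X (Suc N)"
        using mono[of N] mono[of "Suc N"] by (intro mult_right_mono nonneg) linarith
      then show ?thesis using Suc False unfolding S by (simp add: mult_ac)
    qed
  qed
  show ?thesis
  proof (cases N)
    case 0 then show ?thesis by simp
  next
    case (Suc M)
    have "X (Suc M) * X (Suc M) \<le> X (Suc M) * X M" by (intro mult_left_mono mono nonneg)
    with prod[of M] show ?thesis unfolding Suc power2_eq_square by linarith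
  qed
qed

text \<open>Chosen such that \<open>2 ^ flow_level c \<tau> p0 n j\<close> is \<open>2 ^ p0\<close> times the expansion of coordinate \<open>j\<close> at time
  \<open>\<tau> * n\<close> (1 if the coordinate is contracted), rounded down to a power of 2. Rounding to powers of 2 makes the boxes of successive generations
  nested.\<close>

definition flow_level :: "real^'n \<Rightarrow> real \<Rightarrow> nat \<Rightarrow> nat \<Rightarrow> 'n \<Rightarrow> nat" where
  "flow_level c \<tau> p0 n j = p0 + nat \<lfloor>max (c $ j) 0 * \<tau> * real n / ln 2\<rfloor>"

lemma flow_level_mono: "\<tau> \<ge> 0 \<Longrightarrow> n \<le> n' \<Longrightarrow> flow_level c \<tau> p0 n j \<le> flow_level c \<tau> p0 n' j"
  unfolding flow_level_def by (intro add_left_mono nat_mono floor_mono divide_right_mono mult_left_mono) auto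

lemma flow_level_bounds:
  assumes "\<tau> \<ge> 0"
  shows "2 ^ flow_level c \<tau> p0 n j \<le> 2 ^ p0 * exp (max (c $ j) 0 * \<tau> * real n)"
    and "2 * 2 ^ flow_level c \<tau> p0 n j > 2 ^ p0 * exp (max (c $ j) 0 * \<tau> * real n)"
proof -
  define y where "y = max (c $ j) 0 * \<tau> * real n / ln 2"
  have y: "y \<ge> 0" unfolding y_def using assms by auto
  have ey: "2 powr y = exp (max (c $ j) 0 * \<tau> * real n)" by (simp add: powr_def y_def)
  have l: "(2::real) ^ flow_level c \<tau> p0 n j = 2 ^ p0 * 2 powr real_of_int \<lfloor>y\<rfloor>"
    unfolding flow_level_def y_def[symmetric] using y by (simp add: power_add powr_real_of_int' flip: powr_realpow)
  have "2 powr real_of_int \<lfloor>y\<rfloor> \<le> 2 powr y" by (intro powr_mono) auto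
  then show "2 ^ flow_level c \<tau> p0 n j \<le> 2 ^ p0 * exp (max (c $ j) 0 * \<tau> * real n)"
    unfolding l ey[symmetric] by simp
  have "2 powr y < 2 powr (real_of_int \<lfloor>y\<rfloor> + 1)" by (intro powr_less_mono) linarith+
  then show "2 * 2 ^ flow_level c \<tau> p0 n j > 2 ^ p0 * exp (max (c $ j) 0 * \<tau> * real n)"
    unfolding l ey[symmetric] by (simp add: powr_add)
qed

lemma diag_flow_mult_vec: "(diag_flow c t *v v) $ j = exp (c $ j * t) * v $ j"
  by (simp add: diag_flow_def matrix_vector_mult_def if_distrib if_distribR cong: if_cong)

text \<open>Let \<open>P\<close> be the centre of the box with code \<open>b\<close>. A lattice vector \<open>v\<close> is chosen such that, at time
  \<open>n + 1\<close>, the centre \<open>\<zeta>\<close> of the translated preimage of the target box is within \<open>D\<close> of \<open>P\<close> in every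
  coordinate. In an expanding coordinate this error is small against the image of the box, so \<open>\<zeta>\<close> lies in
  the box and the subbox around \<open>\<zeta>\<close> is taken; it is short enough to be mapped into the target. In a
  contracting coordinate the box is not subdivided, and the error and the side of the box are both small
  against the preimage of the target, so that the whole side of the box is mapped into the target.\<close>

lemma box_child_in_lattice_translates:
  fixes c q :: "real^'n" and x :: "(real^'n) set"
  assumes \<tau>: "\<tau> > 0" and p0: "2 \<le> \<rho> * 2 ^ p0"
    and expanding: "\<And>j. c $ j > 0 \<Longrightarrow> 2 * D * 2 ^ p0 < exp (c $ j * \<tau>)"
    and contracting: "\<And>j. \<not> c $ j > 0 \<Longrightarrow> 2 * D \<le> \<rho> * exp (- (c $ j) * \<tau>)"
    and cover: "\<And>u. \<exists>z\<in>(*v) (diag_flow c (\<tau> * Suc n)) ` x. \<forall>j. \<bar>z $ j - u $ j\<bar> \<le> D"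
  shows "\<exists>k\<in>code_children (\<lambda>j. flow_level c \<tau> p0 (Suc (Suc n)) j - flow_level c \<tau> p0 n j) b.
    \<forall>w. cube_code (flow_level c \<tau> p0 (Suc (Suc n))) w = k \<longrightarrow>
      (\<exists>v\<in>x. \<forall>j. \<bar>exp (c $ j * (\<tau> * Suc (Suc n))) * (w $ j - v $ j) - q $ j\<bar> < \<rho>)"
proof -
  let ?p = "flow_level c \<tau> p0 n" and ?p' = "flow_level c \<tau> p0 (Suc (Suc n))"
  define P :: "'n \<Rightarrow> real" where "P j = (of_int (b j) + 1/2) / 2 ^ ?p j" for j
  \<comment> \<open>The position of a lattice point at time \<open>n + 1\<close> that would make \<open>\<zeta>\<close> equal to the centre \<open>P\<close>.\<close>
  define u where "u = (\<chi> j. exp (c $ j * (\<tau> * Suc n)) * P j - exp (- (c $ j * \<tau>)) * q $ j)"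
  obtain v where v: "v \<in> x" "\<And>j. \<bar>(diag_flow c (\<tau> * Suc n) *v v) $ j - u $ j\<bar> \<le> D"
    using cover[of u] by auto
  define \<zeta> where "\<zeta> j = v $ j + exp (- (c $ j * (\<tau> * Suc (Suc n)))) * q $ j" for j
  have D: "\<bar>exp (c $ j * (\<tau> * Suc n)) * (\<zeta> j - P j)\<bar> \<le> D" for j
  proof -
    have "exp (c $ j * (\<tau> * Suc n)) * exp (- (c $ j * (\<tau> * Suc (Suc n)))) = exp (- (c $ j * \<tau>))"
      by (simp add: algebra_simps flip: exp_add)
    then have "exp (c $ j * (\<tau> * Suc n)) * (\<zeta> j - P j) = (diag_flow c (\<tau> * Suc n) *v v) $ j - u $ j"
      unfolding \<zeta>_def u_def diag_flow_mult_vec by (simp add: algebra_simps)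
    then show ?thesis using v(2) by simp
  qed
  have \<rho>: "\<rho> > 0" using p0 by (metis less_le_trans zero_less_mult_pos2 zero_less_numeral zero_less_power)
  define k where "k j = (if c $ j > 0 then \<lfloor>2 ^ ?p' j * \<zeta> j\<rfloor> else b j)" for j
  have near: "\<bar>w $ j - \<zeta> j\<bar> * exp (c $ j * (\<tau> * Suc (Suc n))) < \<rho>" if w: "cube_code ?p' w j = k j" for w j
  proof (cases "c $ j > 0")
    case True
    then have "\<lfloor>2 ^ ?p' j * w $ j\<rfloor> = \<lfloor>2 ^ ?p' j * \<zeta> j\<rfloor>" using w by (simp add: cube_code_def k_def)
    then have "\<bar>2 ^ ?p' j * w $ j - 2 ^ ?p' j * \<zeta> j\<bar> < 1" by linarith
    then have "2 ^ ?p' j * \<bar>w $ j - \<zeta> j\<bar> < 1" by (simp add: abs_mult flip: right_diff_distrib)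
    moreover have "2 ^ p0 * exp (c $ j * (\<tau> * Suc (Suc n))) \<le> 2 * 2 ^ ?p' j"
      using flow_level_bounds(2)[of \<tau> p0 c j "Suc (Suc n)"] \<tau> True by (simp add: mult.assoc)
    then have "2 ^ p0 * exp (c $ j * (\<tau> * Suc (Suc n))) * \<bar>w $ j - \<zeta> j\<bar> \<le> 2 * 2 ^ ?p' j * \<bar>w $ j - \<zeta> j\<bar>"
      by (intro mult_right_mono) auto
    ultimately have "2 ^ p0 * (\<bar>w $ j - \<zeta> j\<bar> * exp (c $ j * (\<tau> * Suc (Suc n)))) < 2" by (simp add: mult_ac)
    also have "2 \<le> 2 ^ p0 * \<rho>" using p0 by (simp add: mult.commute)
    finally show ?thesis by simp
  next
    case False
    have lev: "?p j = p0" "?p' j = p0" using False by (simp_all add: flow_level_def max_def)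
    have "\<lfloor>2 ^ p0 * w $ j\<rfloor> = b j" using w False lev by (simp add: cube_code_def k_def)
    then have "\<bar>2 ^ p0 * w $ j - (of_int (b j) + 1/2)\<bar> \<le> 1/2" by linarith
    moreover have "2 ^ p0 * w $ j - (of_int (b j) + 1/2) = 2 ^ p0 * (w $ j - P j)"
      unfolding P_def lev by (simp add: field_simps)
    ultimately have "2 ^ p0 * \<bar>w $ j - P j\<bar> \<le> 1/2" by (simp add: abs_mult)
    then have "2 ^ p0 * (4 * \<bar>w $ j - P j\<bar>) \<le> 2 ^ p0 * \<rho>" 
      using p0 by (simp only: mult.commute[of \<rho>])
    then have wP: "\<bar>w $ j - P j\<bar> \<le> \<rho> / 4" by simp
    have "exp (c $ j * (\<tau> * Suc (Suc n))) \<le> 1" using False \<tau> by (simp add: mult_nonpos_nonneg)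
    then have 1: "\<bar>w $ j - P j\<bar> * exp (c $ j * (\<tau> * Suc (Suc n))) \<le> \<rho> / 4 * 1"
      using wP \<rho> by (intro mult_mono) auto
    have "exp (c $ j * (\<tau> * Suc n)) * \<bar>\<zeta> j - P j\<bar> \<le> D" using D[of j] by (simp add: abs_mult)
    then have "exp (c $ j * \<tau>) * (exp (c $ j * (\<tau> * Suc n)) * \<bar>\<zeta> j - P j\<bar>) \<le> exp (c $ j * \<tau>) * D"
      by (intro mult_left_mono) auto
    moreover have "exp (c $ j * \<tau>) * exp (c $ j * (\<tau> * Suc n)) = exp (c $ j * (\<tau> * Suc (Suc n)))"
      by (simp add: algebra_simps flip: exp_add)
    ultimately have "exp (c $ j * (\<tau> * Suc (Suc n))) * \<bar>\<zeta> j - P j\<bar> \<le> exp (c $ j * \<tau>) * D"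
      by (simp only: mult.assoc[symmetric])
    also have "\<dots> \<le> \<rho> / 2"
      using contracting[OF False] by (simp add: exp_minus field_simps)
    finally have 2: "\<bar>P j - \<zeta> j\<bar> * exp (c $ j * (\<tau> * Suc (Suc n))) \<le> \<rho> / 2"
      by (simp add: mult.commute abs_minus_commute)
    have "\<bar>w $ j - \<zeta> j\<bar> * exp (c $ j * (\<tau> * Suc (Suc n))) \<le> (\<bar>w $ j - P j\<bar> + \<bar>P j - \<zeta> j\<bar>) * exp (c $ j * (\<tau> * Suc (Suc n)))"
      by (intro mult_right_mono) auto
    then show ?thesis using 1 2 \<rho> by (simp add: distrib_right)
  qed
  have "k \<in> code_children (\<lambda>j. ?p' j - ?p j) b"
    unfolding code_children_def
  proof (intro CollectI allI)
    fix j
    show "k j div 2 ^ (?p' j - ?p j) = b j"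
    proof (cases "c $ j > 0")
      case True
      have le: "?p j \<le> ?p' j" using flow_level_mono[of \<tau> n "Suc (Suc n)"] \<tau> by simp
      have "k j div 2 ^ (?p' j - ?p j) = \<lfloor>2 ^ ?p j * \<zeta> j\<rfloor>"
        using True floor_power2_coarsen[of "?p j" "?p' j - ?p j" "\<zeta> j"] le by (simp add: k_def)
      also have "\<dots> = b j"
      proof -
        have "2 ^ ?p j * \<bar>\<zeta> j - P j\<bar> \<le> 2 ^ p0 * exp (c $ j * (\<tau> * n)) * \<bar>\<zeta> j - P j\<bar>"
          using flow_level_bounds(1)[of \<tau> c p0 n j] \<tau> True by (intro mult_right_mono) (auto simp: mult.assoc)
        also have "\<dots> < 1/2"
        proof -
          have e: "exp (c $ j * (\<tau> * Suc n)) = exp (c $ j * \<tau>) * exp (c $ j * (\<tau> * n))"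
            by (simp add: algebra_simps flip: exp_add)
          define t where "t = exp (c $ j * (\<tau> * n)) * \<bar>\<zeta> j - P j\<bar>"
          have t: "exp (c $ j * \<tau>) * t \<le> D" using D[of j] unfolding e t_def by (simp add: abs_mult mult_ac)
          have "t \<ge> 0" by (simp add: t_def)
          have "2 * 2 ^ p0 * t < 1"
          proof (rule ccontr)
            assume "\<not> ?thesis"
            then have t1: "1 \<le> 2 * 2 ^ p0 * t" by simp
            then have "t > 0" using \<open>t \<ge> 0\<close> by (cases "t = 0") auto
            have "exp (c $ j * \<tau>) \<le> exp (c $ j * \<tau>) * (2 * 2 ^ p0 * t)" using t1 by simp
            also have "\<dots> = 2 * 2 ^ p0 * (exp (c $ j * \<tau>) * t)" by (simp add: mult_ac)
            also have "\<dots> \<le> 2 * 2 ^ p0 * D" using t by (intro mult_left_mono) auto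
            finally show False using expanding[OF True] by (simp add: mult_ac)
          qed
          then show ?thesis by (simp add: t_def mult_ac)
        qed
        finally have "\<bar>2 ^ ?p j * (\<zeta> j - P j)\<bar> < 1/2" by (simp add: abs_mult)
        moreover have "2 ^ ?p j * (\<zeta> j - P j) = 2 ^ ?p j * \<zeta> j - (of_int (b j) + 1/2)"
          unfolding P_def by (simp add: right_diff_distrib)
        ultimately have "\<bar>2 ^ ?p j * \<zeta> j - (of_int (b j) + 1/2)\<bar> < 1/2" by simp
        then show ?thesis by linarith
      qed
      finally show ?thesis .
    next
      case False
      then show ?thesis by (simp add: flow_level_def k_def max_def)
    qed
  qed
  moreover have "\<exists>v\<in>x. \<forall>j. \<bar>exp (c $ j * (\<tau> * Suc (Suc n))) * (w $ j - v $ j) - q $ j\<bar> < \<rho>"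
    if w: "cube_code ?p' w = k" for w
  proof (intro bexI[OF _ v(1)] allI)
    fix j
    have distrib: "E * (w $ j - v $ j) - q $ j = (w $ j - (v $ j + F * q $ j)) * E" if "E * F = 1" for E F :: real
    proof -
      have "E * F * q $ j = q $ j" by (simp add: that)
      then show ?thesis by (simp add: algebra_simps)
    qed
    have "exp (c $ j * (\<tau> * Suc (Suc n))) * (w $ j - v $ j) - q $ j = (w $ j - \<zeta> j) * exp (c $ j * (\<tau> * Suc (Suc n)))"
      unfolding \<zeta>_def by (rule distrib) (simp flip: exp_add)
    then show "\<bar>exp (c $ j * (\<tau> * Suc (Suc n))) * (w $ j - v $ j) - q $ j\<bar> < \<rho>"
      using near[of w j] w by (simp add: abs_mult)
  qed
  ultimately show ?thesis by blast
qed

section \<open>Hausdorff measure and countable covers\<close>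

lemma hausdorff_content_eq_0_iff:
  "hausdorff_content M s e A = 0 \<longleftrightarrow>
    (\<forall>\<eta>::real>0. \<exists>U :: nat \<Rightarrow> 'a set. (\<forall>i. U i \<subseteq> mspace M \<and> mdiam M (U i) \<le> ennreal e) \<and>
        A \<subseteq> (\<Union>i. U i) \<and> (\<Sum>i. hausdorff_gauge M s (U i)) \<le> ennreal \<eta>)"
  (is "?L \<longleftrightarrow> ?R")
proof
  assume L: ?L
  show ?R
  proof (intro allI impI)
    fix \<eta> :: real assume "\<eta> > 0"
    then have "hausdorff_content M s e A < ennreal \<eta>" using L by simp
    then obtain v where v: "v < ennreal \<eta>" "v \<in> {(\<Sum>i. hausdorff_gauge M s (U i)) | U :: nat \<Rightarrow> 'a set.
            (\<forall>i. U i \<subseteq> mspace M \<and> mdiam M (U i) \<le> ennreal e) \<and> A \<subseteq> (\<Union>i. U i)}"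
      unfolding hausdorff_content_def Inf_less_iff by (elim bexE)
    from v(2) obtain U :: "nat \<Rightarrow> 'a set" where U: "v = (\<Sum>i. hausdorff_gauge M s (U i))"
      "(\<forall>i. U i \<subseteq> mspace M \<and> mdiam M (U i) \<le> ennreal e) \<and> A \<subseteq> (\<Union>i. U i)"
      unfolding mem_Collect_eq by (elim exE conjE) (rule that; (assumption | (rule conjI; assumption)))
    then show "\<exists>U :: nat \<Rightarrow> 'a set. (\<forall>i. U i \<subseteq> mspace M \<and> mdiam M (U i) \<le> ennreal e) \<and>
        A \<subseteq> (\<Union>i. U i) \<and> (\<Sum>i. hausdorff_gauge M s (U i)) \<le> ennreal \<eta>"
      using less_imp_le[OF v(1)] by (intro exI[of _ U]) simp
  qed
next
  assume R: ?R
  show ?L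
  proof (rule ccontr)
    assume "\<not> ?L"
    then obtain \<eta>' where \<eta>': "0 < \<eta>'" "\<eta>' < hausdorff_content M s e A"
      using dense[of 0 "hausdorff_content M s e A"] by (auto simp: zero_less_iff_neq_zero)
    obtain \<eta> where \<eta>: "\<eta>' = ennreal \<eta>" "\<eta> > 0" using \<eta>' by (cases \<eta>') (auto simp: top.not_eq_extremum)
    obtain U where U: "\<forall>i. U i \<subseteq> mspace M \<and> mdiam M (U i) \<le> ennreal e" "A \<subseteq> (\<Union>i. U i)"
      "(\<Sum>i. hausdorff_gauge M s (U i)) \<le> ennreal \<eta>" using R \<eta>(2) by meson
    have "hausdorff_content M s e A \<le> (\<Sum>i. hausdorff_gauge M s (U i))"
      unfolding hausdorff_content_def using U(1,2) by (intro Inf_lower) blast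
    then show False using U(3) \<eta>' \<eta> by simp
  qed
qed

text \<open>The \<open>i\<close>-th set gets a cover of total size at most \<open>\<eta> / 2 ^ (i + 1)\<close>.\<close>

lemma hausdorff_content_UN_eq_0:
  fixes A :: "nat \<Rightarrow> 'a set"
  assumes "\<And>i. hausdorff_content M s e (A i) = 0"
  shows "hausdorff_content M s e (\<Union>i. A i) = 0"
  unfolding hausdorff_content_eq_0_iff
proof (intro allI impI)
  fix \<eta> :: real assume \<eta>: "\<eta> > 0"
  have "\<exists>U :: nat \<Rightarrow> 'a set. (\<forall>k. U k \<subseteq> mspace M \<and> mdiam M (U k) \<le> ennreal e) \<and>
        A i \<subseteq> (\<Union>k. U k) \<and> (\<Sum>k. hausdorff_gauge M s (U k)) \<le> ennreal (\<eta> * (1/2) ^ Suc i)" for i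
    using assms[of i] \<eta> unfolding hausdorff_content_eq_0_iff by simp
  then obtain U :: "nat \<Rightarrow> nat \<Rightarrow> 'a set" where
    U: "\<And>i k. U i k \<subseteq> mspace M \<and> mdiam M (U i k) \<le> ennreal e" "\<And>i. A i \<subseteq> (\<Union>k. U i k)"
      "\<And>i. (\<Sum>k. hausdorff_gauge M s (U i k)) \<le> ennreal (\<eta> * (1/2) ^ Suc i)"
    by metis
  define V where "V n = (case prod_decode n of (i, k) \<Rightarrow> U i k)" for n
  have "(\<Sum>n. hausdorff_gauge M s (V n)) = (\<Sum>i. \<Sum>k. hausdorff_gauge M s (U i k))"
    using suminf_ennreal_2dimen[of "\<lambda>i. \<Sum>k. hausdorff_gauge M s (U i k)" "\<lambda>(i, k). hausdorff_gauge M s (U i k)"]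
    by (simp add: V_def comp_def case_prod_unfold)
  also have "\<dots> \<le> (\<Sum>i. ennreal (\<eta> * (1/2) ^ Suc i))"
    by (intro suminf_le U(3)) auto
  also have "\<dots> = ennreal \<eta>"
    using sums_mult[OF power_half_series, of \<eta>] \<eta> by (intro suminf_ennreal_eq) auto
  finally have "(\<Sum>n. hausdorff_gauge M s (V n)) \<le> ennreal \<eta>" .
  moreover have "(\<Union>i. A i) \<subseteq> (\<Union>n. V n)"
  proof
    fix a assume "a \<in> (\<Union>i. A i)"
    then obtain i k where "a \<in> U i k" using U(2) by blast
    then have "a \<in> V (prod_encode (i, k))" by (simp add: V_def)
    then show "a \<in> (\<Union>n. V n)" by blast
  qed
  moreover have "\<forall>n. V n \<subseteq> mspace M \<and> mdiam M (V n) \<le> ennreal e"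
    using U(1) by (simp add: V_def split: prod.split)
  ultimately show "\<exists>U. (\<forall>i. U i \<subseteq> mspace M \<and> mdiam M (U i) \<le> ennreal e) \<and>
        (\<Union>i. A i) \<subseteq> (\<Union>i. U i) \<and> (\<Sum>i. hausdorff_gauge M s (U i)) \<le> ennreal \<eta>" by blast
qed

lemma hausdorff_content_mono: "A \<subseteq> B \<Longrightarrow> hausdorff_content M s e A \<le> hausdorff_content M s e B"
  unfolding hausdorff_content_def by (intro Inf_superset_mono) blast

lemma hausdorff_measure_eq_0_iff:
  "hausdorff_measure M s A = 0 \<longleftrightarrow> (\<forall>e>0. hausdorff_content M s e A = 0)"
  unfolding hausdorff_measure_def by (auto simp: SUP_eq_iff bot_ennreal[symmetric] SUP_bot_conv)

lemma hausdorff_measure_UN_eq_0: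
  fixes A :: "'i :: countable \<Rightarrow> 'a set"
  assumes "\<And>i. hausdorff_measure M s (A i) = 0" and sub: "B \<subseteq> (\<Union>i. A i)"
  shows "hausdorff_measure M s B = 0"
  unfolding hausdorff_measure_eq_0_iff
proof (intro allI impI)
  fix e :: real assume "e > 0"
  then have "hausdorff_content M s e (\<Union>n. A (from_nat n)) = 0"
    using assms(1) by (intro hausdorff_content_UN_eq_0) (simp add: hausdorff_measure_eq_0_iff)
  moreover have "B \<subseteq> (\<Union>n. A (from_nat n))"
  proof
    fix b assume "b \<in> B"
    then obtain i where "b \<in> A i" using sub by blast
    then have "b \<in> A (from_nat (to_nat i))" by simp
    then show "b \<in> (\<Union>n. A (from_nat n))" by (rule UN_I[OF UNIV_I])
  qed
  ultimately show "hausdorff_content M s e B = 0"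
    using hausdorff_content_mono[of B "\<Union>n. A (from_nat n)" M s e] by simp
qed

lemma hausdorff_dim_le: "0 \<le> s \<Longrightarrow> hausdorff_measure M s A = 0 \<Longrightarrow> hausdorff_dim M A \<le> ereal s"
  unfolding hausdorff_dim_def by (intro Inf_lower) blast

lemma hausdorff_gauge_le:
  assumes "mdiam M U \<le> ennreal r" "r \<ge> 0" "s > 0"
  shows "hausdorff_gauge M s U \<le> ennreal (r powr s)"
proof -
  have "enn2real (mdiam M U) \<le> r" using assms by (simp add: enn2real_leI)
  then have "enn2real (mdiam M U) powr s \<le> r powr s" using assms by (intro powr_mono2) auto
  then show ?thesis using assms by (simp add: hausdorff_gauge_def ennreal_leI)
qed

text \<open>The sum over the cover at scale \<open>2 ^ - P\<close> is at most a constant times \<open>2 powr ((r - s) * P)\<close>. Infinitely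
  many scales suffice since a single good cover bounds the content.\<close>

lemma hausdorff_measure_zero_of_finite_covers:
  assumes s: "s > 0" and "r < s" and K: "K \<ge> 0"
    and cov: "\<exists>\<^sub>\<infinity>P. \<exists>S. finite S \<and> real (card S) \<le> M0 * 2 powr (r * real P) \<and>
      (\<forall>U\<in>S. U \<subseteq> mspace M \<and> mdiam M U \<le> ennreal (K / 2 ^ P)) \<and> A \<subseteq> \<Union>S"
  shows "hausdorff_measure M s A = 0"
  unfolding hausdorff_measure_eq_0_iff
proof (intro allI impI)
  fix e :: real assume e: "e > 0"
  show "hausdorff_content M s e A = 0"
    unfolding hausdorff_content_eq_0_iff
  proof (intro allI impI)
    fix \<eta> :: real assume \<eta>: "\<eta> > 0"
    have "(\<lambda>P. K * (1/2) ^ P) \<longlonglongrightarrow> K * 0"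
      by (intro tendsto_intros LIMSEQ_power_zero) auto
    then have l1: "(\<lambda>P. K / 2 ^ P) \<longlonglongrightarrow> 0" by (simp add: power_divide)
    have "(\<lambda>P. M0 * K powr s * (2 powr (r - s)) ^ P) \<longlonglongrightarrow> M0 * K powr s * 0"
    proof (intro tendsto_intros LIMSEQ_power_zero)
      have "2 powr (r - s) < 2 powr 0" using \<open>r < s\<close> by (intro powr_less_mono) auto
      then show "norm (2 powr (r - s) :: real) < 1" by simp
    qed
    moreover have "M0 * K powr s * (2 powr (r - s)) ^ P = M0 * 2 powr (r * real P) * (K / 2 ^ P) powr s" for P
      using K by (simp add: powr_divide powr_power powr_powr algebra_simps powr_diff flip: powr_realpow)
    ultimately have l2: "(\<lambda>P. M0 * 2 powr (r * real P) * (K / 2 ^ P) powr s) \<longlonglongrightarrow> 0" by simp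
    have "eventually (\<lambda>P. K / 2 ^ P < e \<and> M0 * 2 powr (r * real P) * (K / 2 ^ P) powr s < \<eta>) sequentially"
      using order_tendstoD(2)[OF l1 e] order_tendstoD(2)[OF l2 \<eta>] by (rule eventually_conj)
    then have "\<exists>\<^sub>\<infinity>P. (\<exists>S. finite S \<and> real (card S) \<le> M0 * 2 powr (r * real P) \<and>
      (\<forall>U\<in>S. U \<subseteq> mspace M \<and> mdiam M U \<le> ennreal (K / 2 ^ P)) \<and> A \<subseteq> \<Union>S) \<and>
      (K / 2 ^ P < e \<and> M0 * 2 powr (r * real P) * (K / 2 ^ P) powr s < \<eta>)"
      unfolding cofinite_eq_sequentially[symmetric] by (rule frequently_eventually_frequently[OF cov])
    then obtain P S where PS: "finite S" "real (card S) \<le> M0 * 2 powr (r * real P)"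
      "\<And>U. U \<in> S \<Longrightarrow> U \<subseteq> mspace M \<and> mdiam M U \<le> ennreal (K / 2 ^ P)" "A \<subseteq> \<Union>S"
      "K / 2 ^ P < e" "M0 * 2 powr (r * real P) * (K / 2 ^ P) powr s < \<eta>"
      by (auto dest!: INFM_EX)
    obtain f where f: "bij_betw f {0..<card S} S" using ex_bij_betw_nat_finite[OF PS(1)] by blast
    define U where "U i = (if i < card S then f i else {})" for i
    have fS: "f i \<in> S" if "i < card S" for i using bij_betwE[OF f] that by simp
    have "(\<Sum>i. hausdorff_gauge M s (U i)) = (\<Sum>i<card S. hausdorff_gauge M s (U i))"
      by (rule suminf_finite) (auto simp: U_def hausdorff_gauge_def)
    also have "\<dots> \<le> (\<Sum>i<card S. ennreal ((K / 2 ^ P) powr s))"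
      using PS(3) fS K s by (intro sum_mono hausdorff_gauge_le) (auto simp: U_def)
    also have "\<dots> = ennreal (real (card S) * (K / 2 ^ P) powr s)"
      by (simp add: ennreal_of_nat_eq_real_of_nat ennreal_mult)
    also have "\<dots> \<le> ennreal \<eta>"
    proof (rule ennreal_leI)
      have "real (card S) * (K / 2 ^ P) powr s \<le> M0 * 2 powr (r * real P) * (K / 2 ^ P) powr s"
        using PS(2) by (intro mult_right_mono) auto
      then show "real (card S) * (K / 2 ^ P) powr s \<le> \<eta>" using PS(6) by linarith
    qed
    finally have "(\<Sum>i. hausdorff_gauge M s (U i)) \<le> ennreal \<eta>" .
    moreover have "A \<subseteq> (\<Union>i. U i)"
    proof
      fix a assume "a \<in> A"
      then obtain V where "V \<in> S" "a \<in> V" using PS(4) by blast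
      have "V \<in> f ` {0..<card S}" using \<open>V \<in> S\<close> bij_betw_imp_surj_on[OF f] by metis
      then obtain i where "i < card S" "V = f i" by auto
      then have "a \<in> U i" using \<open>a \<in> V\<close> by (simp add: U_def)
      then show "a \<in> (\<Union>i. U i)" by (rule UN_I[OF UNIV_I])
    qed
    moreover have "\<forall>i. U i \<subseteq> mspace M \<and> mdiam M (U i) \<le> ennreal e"
    proof
      fix i
      have "ennreal (K / 2 ^ P) \<le> ennreal e" using PS(5) by (intro ennreal_leI) simp
      then show "U i \<subseteq> mspace M \<and> mdiam M (U i) \<le> ennreal e"
        using PS(3)[OF fS[of i]] by (cases "i < card S") (simp_all add: U_def mdiam_def, meson order_trans)
    qed
    ultimately show "\<exists>U. (\<forall>i. U i \<subseteq> mspace M \<and> mdiam M (U i) \<le> ennreal e) \<and>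
        A \<subseteq> (\<Union>i. U i) \<and> (\<Sum>i. hausdorff_gauge M s (U i)) \<le> ennreal \<eta>"
      by (intro exI[of _ U] conjI)
  qed
qed

section \<open>Exponential decay of the number of boxes\<close>

text \<open>Up to a constant there are at least \<open>N / 2\<close> good indices below \<open>N\<close>, and the square in \<open>two_step_decay\<close>
  halves the exponent once more, which gives the factor 4.\<close>

lemma frequent_two_step_decay:
  fixes X :: "nat \<Rightarrow> real"
  assumes nonneg: "\<And>n. X n \<ge> 0" and mono: "\<And>n. X (Suc n) \<le> X n" and "X 0 \<le> 1"
    and \<theta>: "0 < \<theta>" "\<theta> < 1"
    and good: "\<And>n. G (Suc n) \<Longrightarrow> T \<le> n \<Longrightarrow> X (Suc (Suc n)) \<le> \<theta> * X n"
    and often: "\<exists>C. \<exists>\<^sub>\<infinity>N. N \<le> 2 * card {n. n < N \<and> G n} + C"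
  shows "\<exists>C. \<exists>\<^sub>\<infinity>N. X N \<le> \<theta> powr ((real N - C) / 4)"
proof -
  obtain C where C: "\<exists>\<^sub>\<infinity>N. N \<le> 2 * card {n. n < N \<and> G n} + C" using often by blast
  have "X N \<le> \<theta> powr ((real N - real (C + 2 * Suc T)) / 4)" if N: "N \<le> 2 * card {n. n < N \<and> G n} + C" for N
  proof -
    define g where "g = card {n. n < N \<and> n > 0 \<and> (G n \<and> T < n)}"
    have "{n. n < N \<and> G n} \<subseteq> {n. n < N \<and> n > 0 \<and> (G n \<and> T < n)} \<union> {..T}" by auto
    then have "card {n. n < N \<and> G n} \<le> card ({n. n < N \<and> n > 0 \<and> (G n \<and> T < n)} \<union> {..T})"
      by (intro card_mono) auto
    also have "\<dots> \<le> g + card {..T}" unfolding g_def by (rule card_Un_le)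
    finally have "real N \<le> 2 * real g + real (C + 2 * Suc T)" using N by simp
    then have g: "(real N - real (C + 2 * Suc T)) / 4 \<le> real g / 2" by simp
    have "(X N)\<^sup>2 \<le> \<theta> ^ g * (X 0)\<^sup>2"
      unfolding g_def using nonneg mono \<theta>(1) good by (intro two_step_decay) auto
    also have "\<dots> \<le> \<theta> ^ g * 1"
      using \<theta> \<open>X 0 \<le> 1\<close> nonneg by (intro mult_left_mono power_le_one) auto
    also have "\<dots> = (\<theta> powr (real g / 2))\<^sup>2"
      using \<theta> by (simp add: powr_realpow flip: powr_realpow powr_add add: power2_eq_square)
    finally have "X N \<le> \<theta> powr (real g / 2)" by (rule power2_le_imp_le) simp
    also have "\<dots> \<le> \<theta> powr ((real N - real (C + 2 * Suc T)) / 4)"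
      using g \<theta> by (intro powr_mono') auto
    finally show ?thesis .
  qed
  then show ?thesis by (intro exI[of _ "real (C + 2 * Suc T)"]) (rule INFM_mono[OF C])
qed

lemma flow_level_two_steps:
  assumes "\<tau> \<ge> 0"
  shows "flow_level c \<tau> p0 (Suc (Suc n)) j - flow_level c \<tau> p0 n j \<le> nat \<lceil>2 * max (c $ j) 0 * \<tau> / ln 2\<rceil>"
proof -
  define y z where "y = max (c $ j) 0 * \<tau> * real n / ln 2" and "z = 2 * max (c $ j) 0 * \<tau> / ln 2"
  have "max (c $ j) 0 * \<tau> * real (Suc (Suc n)) / ln 2 = y + z"
    by (simp add: y_def z_def field_simps)
  moreover have "\<lfloor>y + z\<rfloor> \<le> \<lfloor>y\<rfloor> + \<lceil>z\<rceil>" by linarith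
  moreover have "0 \<le> y" "0 \<le> z" using assms by (auto simp: y_def z_def)
  ultimately show ?thesis unfolding flow_level_def by (simp flip: y_def z_def)
qed

lemma sum_add_sum_diff:
  fixes p p' :: "'n::finite \<Rightarrow> nat"
  assumes "\<And>j. p j \<le> p' j"
  shows "sum p UNIV + (\<Sum>j\<in>UNIV. p' j - p j) = sum p' UNIV"
  unfolding sum.distrib[symmetric] using assms by (intro sum.cong) auto

text \<open>\<open>X n\<close> is the number of boxes of generation \<open>n\<close> that meet \<open>A\<close>, relative to the number of all such boxes in
  a unit cube. It loses at least one of at most \<open>2 ^ R\<close> subboxes, hence the factor \<open>\<theta>\<close>, at each
  good time. Passing to cubes of the side in the most expanding coordinate \<open>jm\<close>, whose exponent is \<open>P\<close>,
  multiplies all counts alike, and \<open>P\<close> grows linearly with the generation at rate \<open>cm * \<tau> / ln 2\<close>. So a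
  decay in the generation is a decay in \<open>P\<close> with the exponent \<open>\<delta>\<close>. The bound \<open>r\<close> is obtained before \<open>x\<close>,
  \<open>A\<close> and \<open>T\<close>, as it has to be uniform in the lattice.\<close>

lemma box_count_decay:
  fixes c q :: "real^'n"
  assumes \<tau>: "\<tau> > 0" and p0: "2 \<le> \<rho> * 2 ^ p0"
    and expanding: "\<And>j. c $ j > 0 \<Longrightarrow> 2 * D * 2 ^ p0 < exp (c $ j * \<tau>)"
    and contracting: "\<And>j. \<not> c $ j > 0 \<Longrightarrow> 2 * D \<le> \<rho> * exp (- (c $ j) * \<tau>)"
    and pos: "c $ i0 > 0"
  obtains r where "r < real CARD('n)"
    and "\<And>x A T k0. \<lbrakk>\<And>w. w \<in> A \<Longrightarrow> cube_code (\<lambda>_. p0) w = k0;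
      \<And>w n v. w \<in> A \<Longrightarrow> n \<ge> T \<Longrightarrow> v \<in> x \<Longrightarrow> \<not> (\<forall>j. \<bar>exp (c $ j * (\<tau> * real n)) * (w $ j - v $ j) - q $ j\<bar> < \<rho>);
      \<exists>C. \<exists>\<^sub>\<infinity>N. N \<le> 2 * card {n. n < N \<and> (\<forall>u. \<exists>z\<in>(*v) (diag_flow c (\<tau> * real n)) ` x. \<forall>j. \<bar>z $ j - u $ j\<bar> \<le> D)} + C\<rbrakk>
      \<Longrightarrow> \<exists>M0. \<exists>\<^sub>\<infinity>P. finite (cube_code (\<lambda>_. P) ` A) \<and> real (card (cube_code (\<lambda>_. P) ` A)) \<le> M0 * 2 powr (r * real P)"
proof -
  define R where "R = Suc (\<Sum>j\<in>UNIV. nat \<lceil>2 * max (c $ j) 0 * \<tau> / ln 2\<rceil>)"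
  define \<theta> :: real where "\<theta> = 1 - 1 / 2 ^ R"
  have "1 / 2 ^ R \<le> (1 / 2 :: real)" by (simp add: R_def)
  then have \<theta>: "0 < \<theta>" "\<theta> < 1" by (simp_all add: \<theta>_def)
  obtain jm where jm: "\<And>j. c $ j \<le> c $ jm"
  proof -
    have "Max (range (($) c)) \<in> range (($) c)" by (rule Max_in) auto
    then obtain jm where "Max (range (($) c)) = c $ jm" by (rule imageE)
    then have "c $ j \<le> c $ jm" for j using Max_ge[of "range (($) c)" "c $ j"] by simp
    then show ?thesis by (rule that)
  qed
  define cm where "cm = c $ jm"
  have cm: "cm > 0" using jm[of i0] pos by (simp add: cm_def)
  define \<delta> where "\<delta> = - ln \<theta> / (4 * cm * \<tau>)"
  have \<delta>: "\<delta> > 0" unfolding \<delta>_def using \<theta> cm \<tau> by (intro divide_pos_pos) auto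
  define r where "r = real CARD('n) - \<delta>"
  have "\<exists>M0. \<exists>\<^sub>\<infinity>P. finite (cube_code (\<lambda>_. P) ` A) \<and> real (card (cube_code (\<lambda>_. P) ` A)) \<le> M0 * 2 powr (r * real P)"
    if code0: "\<And>w. w \<in> A \<Longrightarrow> cube_code (\<lambda>_. p0) w = k0"
      and avoid: "\<And>w n v. w \<in> A \<Longrightarrow> n \<ge> T \<Longrightarrow> v \<in> x \<Longrightarrow> \<not> (\<forall>j. \<bar>exp (c $ j * (\<tau> * real n)) * (w $ j - v $ j) - q $ j\<bar> < \<rho>)"
      and often: "\<exists>C. \<exists>\<^sub>\<infinity>N. N \<le> 2 * card {n. n < N \<and> (\<forall>u. \<exists>z\<in>(*v) (diag_flow c (\<tau> * real n)) ` x. \<forall>j. \<bar>z $ j - u $ j\<bar> \<le> D)} + C"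
    for x A :: "(real^'n) set" and T k0
  proof -
    define p where "p = flow_level c \<tau> p0"
    have p_mono: "p n j \<le> p n' j" if "n \<le> n'" for n n' j
      unfolding p_def by (rule flow_level_mono[OF less_imp_le[OF \<tau>] that])
    have p_0: "p 0 = (\<lambda>_. p0)" by (simp add: p_def flow_level_def fun_eq_iff)
    have "cube_code (p 0) ` A \<subseteq> {k0}" unfolding p_0 using code0 by blast
    then have fin0: "finite (cube_code (p 0) ` A)" and card0: "card (cube_code (p 0) ` A) \<le> 1"
      using finite_subset card_mono[of "{k0}"] by auto
    have fin: "finite (cube_code (p n) ` A)" for n
      by (rule card_cube_codes_refine(1)[OF p_mono fin0]) simp
    define X where "X n = real (card (cube_code (p n) ` A)) / 2 ^ sum (p n) UNIV" for n
    have ratio: "real (card (cube_code (p n') ` A)) / 2 ^ sum (p n') UNIV \<le> \<kappa> * X n"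
      if "n \<le> n'" "real (card (cube_code (p n') ` A)) \<le> real (card (cube_code (p n) ` A)) * (\<kappa> * 2 ^ (\<Sum>j\<in>UNIV. p n' j - p n j))"
      for n n' \<kappa>
    proof -
      have "sum (p n) UNIV + (\<Sum>j\<in>UNIV. p n' j - p n j) = sum (p n') UNIV"
        by (rule sum_add_sum_diff) (rule p_mono[OF that(1)])
      then have "(2::real) ^ sum (p n') UNIV = 2 ^ sum (p n) UNIV * 2 ^ (\<Sum>j\<in>UNIV. p n' j - p n j)"
        by (simp flip: power_add)
      then show ?thesis using that(2) by (simp add: X_def field_simps)
    qed
    have "\<exists>C. \<exists>\<^sub>\<infinity>N. X N \<le> \<theta> powr ((real N - C) / 4)"
    proof (rule frequent_two_step_decay[OF _ _ _ \<theta> _ often])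
      show "X n \<ge> 0" for n by (simp add: X_def)
      show "X 0 \<le> 1"
      proof -
        have "real (card (cube_code (p 0) ` A)) \<le> 1" using card0 by linarith
        also have "\<dots> \<le> 2 ^ sum (p 0) UNIV" by (rule one_le_power) simp
        finally show ?thesis unfolding X_def by (subst divide_le_eq_1_pos) simp_all
      qed
      show "X (Suc n) \<le> X n" for n
      proof -
        have "card (cube_code (p (Suc n)) ` A) \<le> card (cube_code (p n) ` A) * 2 ^ (\<Sum>j\<in>UNIV. p (Suc n) j - p n j)"
          by (rule card_cube_codes_refine(2)[OF p_mono fin]) simp
        then have "real (card (cube_code (p (Suc n)) ` A)) \<le> real (card (cube_code (p n) ` A) * 2 ^ (\<Sum>j\<in>UNIV. p (Suc n) j - p n j))"
          by (rule of_nat_mono)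
        also have "\<dots> = real (card (cube_code (p n) ` A)) * (1 * 2 ^ (\<Sum>j\<in>UNIV. p (Suc n) j - p n j))"
          by (simp only: of_nat_mult of_nat_power of_nat_numeral mult_1)
        finally have "real (card (cube_code (p (Suc n)) ` A)) \<le> real (card (cube_code (p n) ` A)) * (1 * 2 ^ (\<Sum>j\<in>UNIV. p (Suc n) j - p n j))" .
        from ratio[OF _ this] show ?thesis by (simp add: X_def)
      qed
      fix n
      assume cover: "\<forall>u. \<exists>z\<in>(*v) (diag_flow c (\<tau> * real (Suc n))) ` x. \<forall>j. \<bar>z $ j - u $ j\<bar> \<le> D" and "T \<le> n"
      define s where "s = (\<Sum>j\<in>UNIV. p (Suc (Suc n)) j - p n j)"
      have "card (cube_code (p (Suc (Suc n))) ` A) \<le> card (cube_code (p n) ` A) * (2 ^ s - 1)"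
        unfolding s_def
      proof (rule card_cube_codes_refine_gap[OF p_mono fin])
        fix b
        obtain k where k: "k \<in> code_children (\<lambda>j. p (Suc (Suc n)) j - p n j) b"
          "\<And>w. cube_code (p (Suc (Suc n))) w = k \<Longrightarrow>
            (\<exists>v\<in>x. \<forall>j. \<bar>exp (c $ j * (\<tau> * Suc (Suc n))) * (w $ j - v $ j) - q $ j\<bar> < \<rho>)"
          using box_child_in_lattice_translates[OF \<tau> p0 expanding contracting cover[rule_format], where b = b]
          unfolding p_def by blast
        have "k \<notin> cube_code (p (Suc (Suc n))) ` A"
        proof
          assume "k \<in> cube_code (p (Suc (Suc n))) ` A"
          then obtain w where w: "w \<in> A" "cube_code (p (Suc (Suc n))) w = k" by blast
          obtain v where "v \<in> x" "\<forall>j. \<bar>exp (c $ j * (\<tau> * Suc (Suc n))) * (w $ j - v $ j) - q $ j\<bar> < \<rho>"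
            using k(2)[OF w(2)] by blast
          then show False using avoid[OF w(1), of "Suc (Suc n)" v] \<open>T \<le> n\<close> by simp
        qed
        with k(1) show "\<exists>k\<in>code_children (\<lambda>j. p (Suc (Suc n)) j - p n j) b. k \<notin> cube_code (p (Suc (Suc n))) ` A"
          by (intro bexI[of _ k])
      qed simp
      then have "real (card (cube_code (p (Suc (Suc n))) ` A)) \<le> real (card (cube_code (p n) ` A) * (2 ^ s - 1))"
        by (simp only: of_nat_le_iff)
      also have "\<dots> = real (card (cube_code (p n) ` A)) * (2 ^ s - 1)" by (simp add: of_nat_diff)
      also have "\<dots> \<le> real (card (cube_code (p n) ` A)) * (\<theta> * 2 ^ s)"
      proof (intro mult_left_mono)
        have "s \<le> (\<Sum>j\<in>UNIV. nat \<lceil>2 * max (c $ j) 0 * \<tau> / ln 2\<rceil>)"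
          unfolding s_def p_def using \<tau> by (intro sum_mono flow_level_two_steps) simp
        then have "s \<le> R" by (simp add: R_def)
        then have "(2::real) ^ s \<le> 2 ^ R" by (intro power_increasing) auto
        then have "2 ^ s / 2 ^ R \<le> (1::real)" by simp
        then show "2 ^ s - 1 \<le> \<theta> * 2 ^ s" by (simp add: \<theta>_def left_diff_distrib)
      qed simp
      finally have "real (card (cube_code (p (Suc (Suc n))) ` A)) \<le> real (card (cube_code (p n) ` A)) * (\<theta> * 2 ^ s)" .
      from ratio[OF _ this[unfolded s_def]] show "X (Suc (Suc n)) \<le> \<theta> * X n" by (simp add: X_def)
    qed
    then obtain C where C: "\<exists>\<^sub>\<infinity>N. X N \<le> \<theta> powr ((real N - C) / 4)" by blast
    define M0 where "M0 = exp (ln \<theta> * (- (real p0 * ln 2 / (cm * \<tau>)) - C) / 4)"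
    have step: "finite (cube_code (\<lambda>_. p N jm) ` A) \<and> real (card (cube_code (\<lambda>_. p N jm) ` A)) \<le> M0 * 2 powr (r * real (p N jm))"
      if N: "X N \<le> \<theta> powr ((real N - C) / 4)" for N
    proof -
      let ?P = "p N jm"
      have le: "p N j \<le> ?P" for j
        unfolding p_def flow_level_def using jm[of j] \<tau>
        by (intro add_left_mono nat_mono floor_mono divide_right_mono mult_right_mono) auto
      note refine = card_cube_codes_refine[of "p N" "\<lambda>_. ?P", OF le fin]
      have sum: "sum (p N) UNIV + (\<Sum>j\<in>UNIV. ?P - p N j) = CARD('n) * ?P"
        using sum_add_sum_diff[of "p N" "\<lambda>_. ?P", OF le] by simp
      have "real (card (cube_code (\<lambda>_. ?P) ` A)) \<le> real (card (cube_code (p N) ` A) * 2 ^ (\<Sum>j\<in>UNIV. ?P - p N j))"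
        using refine(2) by (simp only: of_nat_le_iff)
      also have "\<dots> = X N * (2 ^ sum (p N) UNIV * 2 ^ (\<Sum>j\<in>UNIV. ?P - p N j))"
        by (simp add: X_def)
      also have "\<dots> = X N * 2 powr (real CARD('n) * real ?P)"
        unfolding power_add[symmetric] sum by (simp flip: powr_realpow)
      also have "\<dots> \<le> \<theta> powr ((real N - C) / 4) * 2 powr (real CARD('n) * real ?P)"
        using N by (intro mult_right_mono) auto
      also have "\<dots> \<le> M0 * 2 powr (- \<delta> * real ?P) * 2 powr (real CARD('n) * real ?P)"
      proof (intro mult_right_mono)
        have "2 ^ ?P \<le> 2 ^ p0 * exp (cm * \<tau> * real N)"
          using flow_level_bounds(1)[of \<tau> c p0 N jm] \<tau> cm unfolding p_def cm_def by simp
        then have "ln (2 ^ ?P) \<le> ln (2 ^ p0 * exp (cm * \<tau> * real N) :: real)" by (subst ln_le_cancel_iff) auto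
        then have "real ?P * ln 2 \<le> real p0 * ln 2 + cm * \<tau> * real N" by (simp add: ln_mult ln_realpow)
        then have "(real ?P * ln 2 - real p0 * ln 2) / (cm * \<tau>) \<le> real N"
          using cm \<tau> by (simp add: field_simps)
        then have e1: "ln \<theta> * real N \<le> ln \<theta> * ((real ?P * ln 2 - real p0 * ln 2) / (cm * \<tau>))"
          using \<theta> by (intro mult_left_mono_neg) auto
        have e2: "\<theta> powr ((real N - C) / 4) = exp ((ln \<theta> * real N - ln \<theta> * C) / 4)"
          using \<theta> by (simp add: powr_def algebra_simps)
        have e3: "M0 * 2 powr (- \<delta> * real ?P) = exp ((ln \<theta> * ((real ?P * ln 2 - real p0 * ln 2) / (cm * \<tau>)) - ln \<theta> * C) / 4)"
        proof -
          have "M0 * 2 powr (- \<delta> * real ?P) = exp (ln \<theta> * (- (real p0 * ln 2 / (cm * \<tau>)) - C) / 4 + - \<delta> * real ?P * ln 2)"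
            by (simp add: M0_def powr_def flip: exp_add)
          also have "ln \<theta> * (- (real p0 * ln 2 / (cm * \<tau>)) - C) / 4 + - \<delta> * real ?P * ln 2 =
            (ln \<theta> * ((real ?P * ln 2 - real p0 * ln 2) / (cm * \<tau>)) - ln \<theta> * C) / 4"
            using cm \<tau> by (simp add: \<delta>_def field_simps)
          finally show ?thesis .
        qed
        show "\<theta> powr ((real N - C) / 4) \<le> M0 * 2 powr (- \<delta> * real ?P)"
          unfolding e2 e3 exp_le_cancel_iff by (intro divide_right_mono diff_right_mono e1) simp
      qed simp
      also have "\<dots> = M0 * 2 powr (r * real ?P)" by (simp add: r_def left_diff_distrib powr_diff powr_minus field_simps)
      finally show ?thesis using refine(1) by blast
    qed
    have "\<exists>\<^sub>\<infinity>P. finite (cube_code (\<lambda>_. P) ` A) \<and> real (card (cube_code (\<lambda>_. P) ` A)) \<le> M0 * 2 powr (r * real P)"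
      unfolding INFM_nat
    proof
      fix m
      obtain N0 where N0: "real (Suc m) / (cm * \<tau> / ln 2) < real N0" using reals_Archimedean2 by blast
      obtain N where N: "N > N0" "X N \<le> \<theta> powr ((real N - C) / 4)" using C unfolding INFM_nat by blast
      have "real (Suc m) / (cm * \<tau> / ln 2) < real N" using N0 N(1) by linarith
      then have "real (Suc m) < cm * \<tau> * real N / ln 2" using cm \<tau> by (simp add: field_simps)
      then have "Suc m \<le> nat \<lfloor>cm * \<tau> * real N / ln 2\<rfloor>" by linarith
      then have "m < p N jm" using cm unfolding p_def flow_level_def cm_def[symmetric] by (simp add: max_def)
      then show "\<exists>P>m. finite (cube_code (\<lambda>_. P) ` A) \<and> real (card (cube_code (\<lambda>_. P) ` A)) \<le> M0 * 2 powr (r * real P)"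
        using step[OF N(2)] by blast
    qed
    then show ?thesis by blast
  qed
  moreover have "r < real CARD('n)" using \<delta> by (simp add: r_def)
  ultimately show ?thesis using that[of r] by blast
qed

section \<open>Grids that meet a spike finitely often\<close>

lemma cube_code_eq_imp_close:
  assumes "cube_code (\<lambda>_. P) w = cube_code (\<lambda>_. P) (w' :: real^'n)"
  shows "dist w w' \<le> real CARD('n) / 2 ^ P"
proof -
  have "\<bar>(w - w') $ j\<bar> \<le> 1 / 2 ^ P" for j
  proof -
    have "\<lfloor>2 ^ P * w $ j\<rfloor> = \<lfloor>2 ^ P * w' $ j\<rfloor>" using fun_cong[OF assms, of j] by (simp add: cube_code_def)
    then have "\<bar>2 ^ P * w $ j - 2 ^ P * w' $ j\<bar> \<le> 1" by linarith
    then have "2 ^ P * \<bar>w $ j - w' $ j\<bar> \<le> 1" by (simp add: abs_mult flip: right_diff_distrib)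
    then show ?thesis by (simp add: field_simps)
  qed
  then have "(\<Sum>j\<in>UNIV. \<bar>(w - w') $ j\<bar>) \<le> (\<Sum>j\<in>(UNIV :: 'n set). 1 / 2 ^ P)" by (intro sum_mono)
  moreover have "norm (w - w') \<le> (\<Sum>j\<in>UNIV. \<bar>(w - w') $ j\<bar>)" by (rule norm_le_l1_cart)
  ultimately show ?thesis by (simp add: dist_norm)
qed

text \<open>The projection to the torus does not increase distances, so a cover of \<open>A\<close> by dyadic cubes projects to
  a cover by sets of no larger diameter.\<close>

lemma hausdorff_measure_torus_zero:
  fixes A :: "(real^'n) set"
  assumes x: "x \<in> unimodular_lattices" and s: "s > 0" "r < s"
    and cov: "\<exists>M0. \<exists>\<^sub>\<infinity>P. finite (cube_code (\<lambda>_. P) ` A) \<and> real (card (cube_code (\<lambda>_. P) ` A)) \<le> M0 * 2 powr (r * real P)"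
  shows "hausdorff_measure (torus_metric x) s ((\<lambda>w. (+) w ` x) ` A) = 0"
proof -
  obtain M0 where M0: "\<exists>\<^sub>\<infinity>P. finite (cube_code (\<lambda>_. P) ` A) \<and> real (card (cube_code (\<lambda>_. P) ` A)) \<le> M0 * 2 powr (r * real P)"
    using cov by blast
  show ?thesis
  proof (rule hausdorff_measure_zero_of_finite_covers[OF s, of "real CARD('n)" M0])
    have "\<exists>S. finite S \<and> real (card S) \<le> M0 * 2 powr (r * real P) \<and>
      (\<forall>V\<in>S. V \<subseteq> mspace (torus_metric x) \<and> mdiam (torus_metric x) V \<le> ennreal (real CARD('n) / 2 ^ P)) \<and>
      (\<lambda>w. (+) w ` x) ` A \<subseteq> \<Union>S"
      if P: "finite (cube_code (\<lambda>_. P) ` A) \<and> real (card (cube_code (\<lambda>_. P) ` A)) \<le> M0 * 2 powr (r * real P)" for P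
    proof -
      define F where "F k = (\<lambda>w. (+) w ` x) ` {w \<in> A. cube_code (\<lambda>_. P) w = k}" for k
      define S where "S = F ` (cube_code (\<lambda>_. P) ` A)"
      have "finite S" "card S \<le> card (cube_code (\<lambda>_. P) ` A)"
        unfolding S_def using P card_image_le by blast+
      moreover have "V \<subseteq> mspace (torus_metric x) \<and> mdiam (torus_metric x) V \<le> ennreal (real CARD('n) / 2 ^ P)" if "V \<in> S" for V
      proof
        obtain k where V: "V = F k" using \<open>V \<in> S\<close> by (auto simp: S_def)
        show "V \<subseteq> mspace (torus_metric x)"
          unfolding V F_def torus_metric_simps[OF x] grid_fibre_eq[OF x] by blast
        show "mdiam (torus_metric x) V \<le> ennreal (real CARD('n) / 2 ^ P)"
          unfolding mdiam_def torus_metric_simps[OF x]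
        proof (intro SUP_least ennreal_leI)
          fix y y' assume "y \<in> V" "y' \<in> V"
          then obtain w w' where w: "y = (+) w ` x" "y' = (+) w' ` x" "cube_code (\<lambda>_. P) w = k" "cube_code (\<lambda>_. P) w' = k"
            unfolding V F_def by blast
          have "w \<in> y" "w' \<in> y'"
            unfolding w using unimodular_lattice_props(1)[OF x] by (auto intro: image_eqI[of _ _ 0])
          then have "setdist y y' \<le> dist w w'" by (rule setdist_le_dist)
          also have "\<dots> \<le> real CARD('n) / 2 ^ P" by (rule cube_code_eq_imp_close) (simp add: w)
          finally show "setdist y y' \<le> real CARD('n) / 2 ^ P" .
        qed
      qed
      moreover have "(\<lambda>w. (+) w ` x) ` A \<subseteq> \<Union>S"
      proof
        fix y assume "y \<in> (\<lambda>w. (+) w ` x) ` A"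
        then obtain w where w: "w \<in> A" "y = (+) w ` x" by blast
        then have "y \<in> F (cube_code (\<lambda>_. P) w)" unfolding F_def by blast
        then show "y \<in> \<Union>S" unfolding S_def using w(1) by blast
      qed
      ultimately show ?thesis using P by (intro exI[of _ S]) auto
    qed
    then show "\<exists>\<^sub>\<infinity>P. \<exists>S. finite S \<and> real (card S) \<le> M0 * 2 powr (r * real P) \<and>
      (\<forall>V\<in>S. V \<subseteq> mspace (torus_metric x) \<and> mdiam (torus_metric x) V \<le> ennreal (real CARD('n) / 2 ^ P)) \<and>
      (\<lambda>w. (+) w ` x) ` A \<subseteq> \<Union>S"
      by (rule INFM_mono[OF M0])
  qed simp
qed

lemma diag_flow_eq: "diag_flow c t = diag_matrix (\<lambda>i. exp (c $ i * t))"
  by (simp add: diag_flow_def diag_matrix_def)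

lemma diag_flow_SL: "(\<Sum>i\<in>UNIV. c $ i) = 0 \<Longrightarrow> diag_flow c t \<in> SL"
  by (simp add: SL_def diag_flow_eq det_diag_matrix flip: exp_sum sum_distrib_right)

lemma funpow_act_diag_flow: "(act (diag_flow c \<tau>) ^^ n) x = act (diag_flow c (\<tau> * real n)) x"
proof (induction n)
  case 0
  have "diag_flow c 0 = mat 1" by (simp add: diag_flow_def mat_def vec_eq_iff)
  then show ?case by simp
next
  case (Suc n)
  have "diag_flow c \<tau> ** diag_flow c (\<tau> * real n) = diag_flow c (\<tau> * real (Suc n))"
    unfolding diag_flow_eq diag_matrix_mult_diag_matrix by (simp add: algebra_simps flip: exp_add)
  then show ?case using Suc by (simp only: funpow.simps comp_def act_act)
qed

text \<open>If \<open>v\<close> is nonzero its orbit escapes to infinity; if it is zero it stays at 0, outside the interval.\<close>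

lemma expanding_coordinate_leaves_interval:
  fixes v q \<rho> k :: real
  assumes "k > 0" "\<rho> \<le> \<bar>q\<bar>"
  shows "eventually (\<lambda>n. \<not> \<bar>exp (k * real n) * v - q\<bar> < \<rho>) sequentially"
proof (cases "v = 0")
  case False
  have "filterlim (\<lambda>n. exp (k * real n)) at_top sequentially"
    by (rule filterlim_compose[OF exp_at_top])
      (intro filterlim_tendsto_pos_mult_at_top[OF tendsto_const assms(1)] filterlim_real_sequentially)
  then have "eventually (\<lambda>n. exp (k * real n) \<ge> (\<bar>q\<bar> + \<rho>) / \<bar>v\<bar>) sequentially"
    by (simp add: filterlim_at_top)
  then show ?thesis
  proof eventually_elim
    case (elim n)
    then have "\<bar>q\<bar> + \<rho> \<le> \<bar>exp (k * real n) * v\<bar>" using False by (simp add: field_simps abs_mult)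
    then show ?case by linarith
  qed
qed (use assms in auto)

lemma finite_grid_eventually_avoids_box:
  fixes c q :: "real^'n"
  assumes fin: "finite (y \<inter> positive_spike c U)" and box: "\<And>z. (\<forall>j. \<bar>z $ j - q $ j\<bar> < \<rho>) \<Longrightarrow> z \<in> U"
    and pos: "c $ i0 > 0" "\<rho> \<le> \<bar>q $ i0\<bar>" and \<tau>: "\<tau> > 0"
  shows "\<exists>T. \<forall>n\<ge>T. \<forall>z\<in>y. \<not> (\<forall>j. \<bar>exp (c $ j * (\<tau> * real n)) * z $ j - q $ j\<bar> < \<rho>)"
proof -
  have "eventually (\<lambda>n. \<forall>z\<in>y \<inter> positive_spike c U. \<not> \<bar>exp ((c $ i0 * \<tau>) * real n) * z $ i0 - q $ i0\<bar> < \<rho>) sequentially"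
    using pos \<tau> by (intro eventually_ball_finite fin ballI expanding_coordinate_leaves_interval) auto
  then obtain T where T: "\<And>n z. n \<ge> T \<Longrightarrow> z \<in> y \<Longrightarrow> z \<in> positive_spike c U \<Longrightarrow> \<not> \<bar>exp ((c $ i0 * \<tau>) * real n) * z $ i0 - q $ i0\<bar> < \<rho>"
    unfolding eventually_sequentially by blast
  show ?thesis
  proof (intro exI[of _ "Suc T"] allI impI ballI notI)
    fix n z assume n: "Suc T \<le> n" and z: "z \<in> y"
      and near: "\<forall>j. \<bar>exp (c $ j * (\<tau> * real n)) * z $ j - q $ j\<bar> < \<rho>"
    have "diag_flow c (\<tau> * real n) *v z \<in> U"
      by (rule box) (simp add: diag_flow_mult_vec near)
    then have "z \<in> positive_spike c U"
      unfolding positive_spike_def using \<tau> n by (intro UN_I[of "\<tau> * real n"]) auto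
    then have "\<not> \<bar>exp ((c $ i0 * \<tau>) * real n) * z $ i0 - q $ i0\<bar> < \<rho>" using T[of n z] n z by simp
    then show False using near[rule_format, of i0] by (simp only: mult.assoc simp_thms)
  qed
qed

lemma open_contains_box_off_hyperplane:
  fixes U :: "(real^'n) set"
  assumes "open U" "U \<noteq> {}"
  obtains q \<rho> where "\<rho> > 0" "\<rho> \<le> \<bar>q $ i0\<bar>" "\<And>z. (\<forall>j. \<bar>z $ j - q $ j\<bar> < \<rho>) \<Longrightarrow> z \<in> U"
proof -
  obtain u e where u: "u \<in> U" "e > 0" "ball u e \<subseteq> U" using assms open_contains_ball by blast
  define q where "q = (if u $ i0 = 0 then u + (e / 2) *\<^sub>R axis i0 1 else u)"
  have "q \<in> U"
  proof -
    have "dist u q < e" using u(2) by (simp add: q_def dist_norm)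
    then show ?thesis using u(3) by (simp add: subset_iff)
  qed
  have q0: "q $ i0 \<noteq> 0" using u(2) by (simp add: q_def)
  obtain e' where e': "e' > 0" "ball q e' \<subseteq> U" using \<open>q \<in> U\<close> assms(1) open_contains_ball by blast
  define \<rho> where "\<rho> = min (e' / real CARD('n)) \<bar>q $ i0\<bar>"
  have "z \<in> U" if z: "\<forall>j. \<bar>z $ j - q $ j\<bar> < \<rho>" for z
  proof -
    have "norm (z - q) \<le> (\<Sum>j\<in>UNIV. \<bar>(z - q) $ j\<bar>)" by (rule norm_le_l1_cart)
    also have "\<dots> < (\<Sum>j\<in>(UNIV :: 'n set). \<rho>)" using z by (intro sum_strict_mono) auto
    also have "\<dots> \<le> e'" using mult_left_mono[of \<rho> "e' / real CARD('n)" "real CARD('n)"] by (simp add: \<rho>_def)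
    finally show ?thesis using e'(2) by (auto simp: dist_norm norm_minus_commute)
  qed
  moreover have "\<rho> > 0" "\<rho> \<le> \<bar>q $ i0\<bar>" using e'(1) q0 by (auto simp: \<rho>_def)
  ultimately show ?thesis using that by blast
qed

text \<open>The bounds \<open>B\<close> and \<open>B'\<close> are those that \<open>box_child_in_lattice_translates\<close> requires in expanding and in
  contracting coordinates.\<close>

lemma exists_time_step:
  fixes c :: "real^'n"
  assumes nz: "\<And>i. c $ i \<noteq> 0" and "\<rho> > 0"
  obtains \<tau> where "\<tau> > 0" "\<And>j. c $ j > 0 \<Longrightarrow> B < exp (c $ j * \<tau>)"
    "\<And>j. \<not> c $ j > 0 \<Longrightarrow> B' \<le> \<rho> * exp (- (c $ j) * \<tau>)"
proof -
  have "eventually (\<lambda>\<tau>. (c $ j > 0 \<longrightarrow> B < exp (c $ j * \<tau>)) \<and> (\<not> c $ j > 0 \<longrightarrow> B' \<le> \<rho> * exp (- (c $ j) * \<tau>))) at_top" for j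
  proof -
    have lim: "filterlim (\<lambda>\<tau>. exp (\<bar>c $ j\<bar> * \<tau>)) at_top at_top"
      by (rule filterlim_compose[OF exp_at_top])
        (use nz[of j] in \<open>intro filterlim_tendsto_pos_mult_at_top[OF tendsto_const] filterlim_ident, simp\<close>)
    have "eventually (\<lambda>\<tau>. B < exp (\<bar>c $ j\<bar> * \<tau>)) at_top" using lim by (simp add: filterlim_at_top_dense)
    moreover have "eventually (\<lambda>\<tau>. B' / \<rho> \<le> exp (\<bar>c $ j\<bar> * \<tau>)) at_top" using lim by (simp add: filterlim_at_top)
    ultimately show ?thesis
    proof eventually_elim
      case (elim \<tau>)
      then show ?case using \<open>\<rho> > 0\<close> nz[of j] by (cases "c $ j > 0") (simp_all add: pos_divide_le_eq mult.commute)
    qed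
  qed
  then have "eventually (\<lambda>\<tau>. \<forall>j\<in>UNIV. (c $ j > 0 \<longrightarrow> B < exp (c $ j * \<tau>)) \<and> (\<not> c $ j > 0 \<longrightarrow> B' \<le> \<rho> * exp (- (c $ j) * \<tau>))) at_top"
    by (intro eventually_ball_finite) auto
  then have "eventually (\<lambda>\<tau>. (\<forall>j\<in>UNIV. (c $ j > 0 \<longrightarrow> B < exp (c $ j * \<tau>)) \<and> (\<not> c $ j > 0 \<longrightarrow> B' \<le> \<rho> * exp (- (c $ j) * \<tau>))) \<and> \<tau> > 0) at_top"
    by (intro eventually_conj eventually_gt_at_top)
  then obtain \<tau> where "(\<forall>j\<in>UNIV. (c $ j > 0 \<longrightarrow> B < exp (c $ j * \<tau>)) \<and> (\<not> c $ j > 0 \<longrightarrow> B' \<le> \<rho> * exp (- (c $ j) * \<tau>))) \<and> \<tau> > 0"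
    using eventually_happens'[OF trivial_limit_at_top_linorder] by blast
  then show ?thesis using that by blast
qed

theorem corollary1p4:
  fixes c :: "real^'n" and U :: "(real^'n) set" and m\<^sub>X :: "(real^'n) set measure"
  assumes "CARD('n) \<ge> 2"
    and "\<forall>i. c $ i \<noteq> 0" and "(\<Sum>i\<in>UNIV. c $ i) = 0"
    and "invariant_lattice_measure m\<^sub>X"
    and "bounded U" and "open U" and "U \<noteq> {}"
  shows "\<exists>\<delta>::real. \<delta> > 0 \<and>
    (AE x in m\<^sub>X. hausdorff_dim (torus_metric x) (finite_grids (positive_spike c U) x)
                  \<le> ereal (real CARD('n) - \<delta>))"
proof -
  interpret lattice_measure m\<^sub>X using assms(4) by unfold_locales
  obtain i0 where i0: "c $ i0 > 0"
  proof -
    have "\<exists>i. c $ i > 0"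
    proof (rule ccontr)
      assume "\<not> ?thesis"
      then have "c $ i < 0" for i using assms(2) by (metis less_linear)
      then have "(\<Sum>i\<in>UNIV. c $ i) < (\<Sum>i\<in>(UNIV :: 'n set). 0)" by (intro sum_strict_mono) auto
      then show False using assms(3) by simp
    qed
    then show ?thesis using that by blast
  qed
  obtain j0 where j0: "c $ j0 \<le> 0"
  proof -
    have "\<exists>i. c $ i \<le> 0"
    proof (rule ccontr)
      assume "\<not> ?thesis"
      then have "(\<Sum>i\<in>UNIV. c $ i) > 0" by (intro sum_pos) (auto simp: not_le)
      then show False using assms(3) by simp
    qed
    then show ?thesis using that by blast
  qed
  obtain q \<rho> where \<rho>: "\<rho> > 0" "\<rho> \<le> \<bar>q $ i0\<bar>" and box: "\<And>z. (\<forall>j. \<bar>z $ j - q $ j\<bar> < \<rho>) \<Longrightarrow> z \<in> U"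
    using open_contains_box_off_hyperplane[OF assms(6,7), of i0] by metis
  obtain p0 where p0: "2 / \<rho> < 2 ^ p0" using real_arch_pow[of 2 "2 / \<rho>"] by auto
  have p0: "2 \<le> \<rho> * 2 ^ p0" using p0 \<rho>(1) by (simp add: field_simps)
  obtain D0 where D0: "prob (bounded_basis_lattices D0) > 3/4"
    using exists_large_bounded_basis_lattices[of "3/4"] by auto
  define K :: "(real^'n) set set" where "K = bounded_basis_lattices D0"
  define D where "D = real CARD('n) * D0"
  obtain \<tau> where \<tau>: "\<tau> > 0" "\<And>j. c $ j > 0 \<Longrightarrow> 2 * D * 2 ^ p0 < exp (c $ j * \<tau>)"
    "\<And>j. \<not> c $ j > 0 \<Longrightarrow> 2 * D \<le> \<rho> * exp (- (c $ j) * \<tau>)"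
    using exists_time_step[OF _ \<rho>(1), of c "2 * D * 2 ^ p0" "2 * D"] assms(2) by metis
  obtain r where r: "r < real CARD('n)" and count: "\<And>x A T k0. \<lbrakk>\<And>w. w \<in> A \<Longrightarrow> cube_code (\<lambda>_. p0) w = k0;
      \<And>w n v. w \<in> A \<Longrightarrow> n \<ge> T \<Longrightarrow> v \<in> x \<Longrightarrow> \<not> (\<forall>j. \<bar>exp (c $ j * (\<tau> * real n)) * (w $ j - v $ j) - q $ j\<bar> < \<rho>);
      \<exists>C. \<exists>\<^sub>\<infinity>N. N \<le> 2 * card {n. n < N \<and> (\<forall>u. \<exists>z\<in>act (diag_flow c (\<tau> * real n)) x. \<forall>j. \<bar>z $ j - u $ j\<bar> \<le> D)} + C\<rbrakk>
      \<Longrightarrow> \<exists>M0. \<exists>\<^sub>\<infinity>P. finite (cube_code (\<lambda>_. P) ` A) \<and> real (card (cube_code (\<lambda>_. P) ` A)) \<le> M0 * 2 powr (r * real P)"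
    using box_count_decay[of \<tau> \<rho> p0 c D i0 q, OF \<tau>(1) p0 \<tau>(2,3) i0] by blast
  \<comment> \<open>The maximum with 0 keeps the exponent positive.\<close>
  define s where "s = (max r 0 + real CARD('n)) / 2"
  have s: "0 < s" "r < s" "s < real CARD('n)" using r by (auto simp: s_def max_def)
  have "AE x in m\<^sub>X. often_in (act (diag_flow c \<tau>)) K x"
    unfolding diag_flow_eq
  proof (rule AE_often_in)
    show "diag_matrix (\<lambda>i. exp (c $ i * \<tau>)) \<in> SL" using diag_flow_SL[OF assms(3)] unfolding diag_flow_eq .
    show "exp (c $ i0 * \<tau>) \<noteq> exp (c $ j0 * \<tau>)" using i0 j0 \<tau>(1) by simp
  qed (use D0 in \<open>auto simp: K_def bounded_basis_lattices_sets\<close>)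
  then have "AE x in m\<^sub>X. hausdorff_dim (torus_metric x) (finite_grids (positive_spike c U) x) \<le> ereal s"
  proof (rule AE_mp[OF _ AE_I2], intro impI)
    fix x assume "x \<in> space m\<^sub>X" and often: "often_in (act (diag_flow c \<tau>)) K x"
    then have x: "x \<in> unimodular_lattices" by (simp add: space_m)
    \<comment> \<open>The admissible translation vectors, sorted by the time \<open>T\<close> from which on the box is avoided and by
    the dyadic cube of side \<open>2 ^ - p0\<close> that contains them.\<close>
    define A where "A = (\<lambda>(T, k). {w. cube_code (\<lambda>_. p0) w = k \<and>
      (\<forall>n\<ge>T. \<forall>v\<in>x. \<not> (\<forall>j. \<bar>exp (c $ j * (\<tau> * real n)) * (w $ j - v $ j) - q $ j\<bar> < \<rho>))})"
    obtain C where C: "\<exists>\<^sub>\<infinity>N. N \<le> 2 * visits (act (diag_flow c \<tau>)) K N x + C"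
      using often unfolding often_in_def by blast
    have "visits (act (diag_flow c \<tau>)) K N x \<le> card {n. n < N \<and> (\<forall>u. \<exists>z\<in>act (diag_flow c (\<tau> * real n)) x. \<forall>j. \<bar>z $ j - u $ j\<bar> \<le> D)}" for N
      unfolding visits_def funpow_act_diag_flow K_def D_def
    proof (rule card_mono)
      show "{n. n < N \<and> act (diag_flow c (\<tau> * real n)) x \<in> bounded_basis_lattices D0} \<subseteq>
        {n. n < N \<and> (\<forall>u. \<exists>z\<in>act (diag_flow c (\<tau> * real n)) x. \<forall>j. \<bar>z $ j - u $ j\<bar> \<le> real CARD('n) * D0)}"
        using bounded_basis_lattice_covering by (intro Collect_mono impI) (elim conjE, intro conjI allI)
    qed simp
    then have "N \<le> 2 * visits (act (diag_flow c \<tau>)) K N x + C \<Longrightarrow>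
      N \<le> 2 * card {n. n < N \<and> (\<forall>u. \<exists>z\<in>act (diag_flow c (\<tau> * real n)) x. \<forall>j. \<bar>z $ j - u $ j\<bar> \<le> D)} + C" for N
      by (meson add_le_mono1 le_trans mult_le_mono2)
    then have often': "\<exists>C. \<exists>\<^sub>\<infinity>N. N \<le> 2 * card {n. n < N \<and> (\<forall>u. \<exists>z\<in>act (diag_flow c (\<tau> * real n)) x. \<forall>j. \<bar>z $ j - u $ j\<bar> \<le> D)} + C"
      by (intro exI[of _ C] INFM_mono[OF C])
    have "hausdorff_measure (torus_metric x) s (finite_grids (positive_spike c U) x) = 0"
    proof (rule hausdorff_measure_UN_eq_0[where A = "\<lambda>i. (\<lambda>w. (+) w ` x) ` A i"])
      fix i :: "nat \<times> ('n \<Rightarrow> int)"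
      obtain T k where i: "i = (T, k)" by (cases i)
      show "hausdorff_measure (torus_metric x) s ((\<lambda>w. (+) w ` x) ` A i) = 0"
      proof (rule hausdorff_measure_torus_zero[OF x s(1,2) count[OF _ _ often']])
        show "cube_code (\<lambda>_. p0) w = k" if "w \<in> A i" for w using that by (simp add: A_def i)
        show "\<not> (\<forall>j. \<bar>exp (c $ j * (\<tau> * real n)) * (w $ j - v $ j) - q $ j\<bar> < \<rho>)"
          if "w \<in> A i" "n \<ge> T" "v \<in> x" for w n v using that by (simp add: A_def i)
      qed
    next
      show "finite_grids (positive_spike c U) x \<subseteq> (\<Union>i. (\<lambda>w. (+) w ` x) ` A i)"
      proof
        fix y assume "y \<in> finite_grids (positive_spike c U) x"
        then obtain w where w: "y = (+) w ` x" and fin: "finite (y \<inter> positive_spike c U)"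
          unfolding finite_grids_def grid_fibre_eq[OF x] by blast
        obtain T where T: "\<And>n z. n \<ge> T \<Longrightarrow> z \<in> y \<Longrightarrow> \<not> (\<forall>j. \<bar>exp (c $ j * (\<tau> * real n)) * z $ j - q $ j\<bar> < \<rho>)"
          using finite_grid_eventually_avoids_box[OF fin box i0 \<rho>(2) \<tau>(1)] by blast
        have "w \<in> A (T, cube_code (\<lambda>_. p0) w)"
          unfolding A_def
        proof (clarsimp simp del: not_all)
          fix n v assume "T \<le> n" "v \<in> x" and near: "\<forall>j. \<bar>exp (c $ j * (\<tau> * real n)) * (w $ j - v $ j) - q $ j\<bar> < \<rho>"
          have "w + - v \<in> y" unfolding w using unimodular_lattice_props(4)[OF x \<open>v \<in> x\<close>] by (rule imageI)
          from T[OF \<open>T \<le> n\<close> this] show False using near by simp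
        qed
        then show "y \<in> (\<Union>i. (\<lambda>w. (+) w ` x) ` A i)" unfolding w by blast
      qed
    qed
    then show "hausdorff_dim (torus_metric x) (finite_grids (positive_spike c U) x) \<le> ereal s"
      using s(1) by (intro hausdorff_dim_le) auto
  qed
  then show ?thesis using s(3) by (intro exI[of _ "real CARD('n) - s"]) auto
qed

end
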